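(* Let $d\ge1$ and let $N,\ell_1,\ldots,\ell_{d+1}$ be positive integers with $\ell_i\le N$ and $\ell_i+\ell_j\ge N$ for $i\neq j$. For $k=1,\ldots,d-1$ set $$\mathcal L^\nu_k:=\mathcal L^\nu_k\big(\boldsymbol\nu_k;\ \ell_1,\ldots,\ell_k,\ |\boldsymbol\ell^{k+1}|-2|\boldsymbol\nu^{k+1}|;\ N-|\boldsymbol\nu^{k+1}|\big),$$ and let $\mathcal L^\nu_d=\mathcal L^\nu_d(\nu;\ell;N)$ (operators defined in the context). Then the normalized Hahn polynomials $\widehat{\mathsf Q}_\nu(x;\ell,N)$ satisfy $$\mathcal L^\nu_k\,\widehat{\mathsf Q}_\nu(x;\ell,N)=|\mathbf x_k|\,\widehat{\mathsf Q}_\nu(x;\ell,N),\qquad k=1,\ldots,d,$$ where $|\mathbf x_k|=x_1+\cdots+x_k$. Here the terms on the left-hand side containing polynomials with a negative index are ignored (their coefficients are zero), and the equation is asserted for those $\nu$ for which the indices of the remaining polynomials occurring on the left-hand side belong to $H_{\ell,N}^d$.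
   Context: Notation: $(a)_k$ is the Pochhammer symbol; $|\cdot|$ of a vector is the sum of its entries; $\boldsymbol\nu_k=(\nu_1,\ldots,\nu_k)$; $|\boldsymbol\nu^{i}|=\nu_i+\cdots+\nu_d$, $|\boldsymbol\nu^{d+1}|=0$; $|\boldsymbol\ell^{i}|=\ell_i+\cdots+\ell_{d+1}$; $|\mathbf x_{j}|=x_1+\cdots+x_{j}$, $|\mathbf x_0|=0$; $\mathsf a_j=|\boldsymbol\ell^{j+1}|-2|\boldsymbol\nu^{j+1}|$. Normalized Hahn polynomials. With $\mathsf Q_n(t;a,b,M)=\sum_{k=0}^n\frac{(-n)_k(n-a-b-1)_k(-t)_k}{(-a)_k(-M)_kk!}$ and $N_j=N-|\mathbf x_{j-1}|-|\boldsymbol\nu^{j+1}|$, $$\widehat{\mathsf Q}_\nu(x;\ell,N)=\frac1{(-N)_{|\nu|}}\prod_{j=1}^d(-N_j)_{\nu_j}\,\mathsf Q_{\nu_j}(x_j;\ell_j,\mathsf a_j,N_j),$$ a polynomial in $x=(x_1,\ldots,x_d)$ (using $(-N_j)_{\nu_j}/(-N_j)_k=(-N_j+k)_{\nu_j-k}$). Index set: $H_{\ell,N}^d=\{\nu\in\mathbb N_0^d:\ |\nu|\le N,\ |\nu|\le|\ell|-N,\ \nu_j\le\ell_j,\ \nu_j\le\mathsf a_j,\ 1\le j\le d\}$. Operators. $E_{\nu_i}$ and $E_{\nu_i}^{-1}$ act on a function $f_\nu$ of $\nu$ by $E_{\nu_i}^{\pm1}f_\nu=f_{\nu\pm e_i}$,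 with $e_i$ the standard basis vectors. For a dimension $d$, index $\nu=(\nu_1,\ldots,\nu_d)$, parameters $\ell=(\ell_1,\ldots,\ell_{d+1})$ and $N$, define for $1\le i\le d$: $B_i^{0,0}=|\boldsymbol\nu^{i}|(|\boldsymbol\nu^{i}|-|\boldsymbol\ell^{i}|-1)+|\boldsymbol\nu^{i+1}|(|\boldsymbol\nu^{i+1}|-|\boldsymbol\ell^{i+1}|-1)+\tfrac12|\boldsymbol\ell^{i+1}|(|\boldsymbol\ell^{i}|+2)$, $B_i^{0,1}=-\nu_i(\nu_i+2|\boldsymbol\nu^{i+1}|-|\boldsymbol\ell^{i}|-1)$, $B_i^{0,-1}=(\ell_i-\nu_i)(\nu_i+2|\boldsymbol\nu^{i+1}|-|\boldsymbol\ell^{i+1}|-1)$, $B_i^{1,0}=(\ell_i-\nu_i)(\nu_i+2|\boldsymbol\nu^{i+1}|-|\boldsymbol\ell^{i}|-1)$, $B_i^{-1,0}=-\nu_i(\nu_i+2|\boldsymbol\nu^{i+1}|-|\boldsymbol\ell^{i+1}|-1)$, $B_i^{1,1}=(\nu_i+2|\boldsymbol\nu^{i+1}|-|\boldsymbol\ell^{i}|-1)(\nu_i+2|\boldsymbol\nu^{i+1}|-|\boldsymbol\ell^{i}|)$, $B_i^{-1,1}=\nu_i(\nu_i-1)$, $B_i^{1,-1}=(\ell_i-\nu_i)(\ell_i-\nu_i-1)$, $B_i^{-1,-1}=(\nu_i+2|\boldsymbol\nu^{i+1}|-|\boldsymbol\ell^{i+1}|-1)(\nu_i+2|\boldsymbol\nu^{i+1}|-|\boldsymbol\ell^{i+1}|-2)$;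 and $B_0^{0,0}=-N+|\ell|/2$, $B_0^{0,1}=N-|\nu|$, $B_0^{0,-1}=|\nu|-|\ell|+N-1$. For $1\le i\le d$ let $b_i^0=\tfrac12(2|\boldsymbol\nu^{i}|-|\boldsymbol\ell^{i}|)(2|\boldsymbol\nu^{i}|-|\boldsymbol\ell^{i}|-2)$, $b_i^1=(2|\boldsymbol\nu^{i}|-|\boldsymbol\ell^{i}|)(2|\boldsymbol\nu^{i}|-|\boldsymbol\ell^{i}|-1)$, $b_i^{-1}=(2|\boldsymbol\nu^{i}|-|\boldsymbol\ell^{i}|-2)(2|\boldsymbol\nu^{i}|-|\boldsymbol\ell^{i}|-1)$. For $\mu=(\mu_1,\ldots,\mu_d)\in\{0,\pm1\}^d$, with $\mu_0=\mu_{d+1}=0$, set $C_\mu=\dfrac{\prod_{k=0}^dB_k^{\mu_k,\mu_{k+1}}}{\prod_{k=1}^db_k^{\mu_k}}$, and define $$\mathcal L^\nu_d(\nu;\ell;N)=\sum_{0\ne\mu\in\{-1,0,1\}^d}C_\mu\left(\prod_{k=1}^dE_{\nu_k}^{\mu_k-\mu_{k+1}}-1\right).$$ The operator $\mathcal L_k^\nu(\boldsymbol\nu_k;\ell_1',\ldots,\ell_{k+1}';N')$ is given by the same formulas with $d$ replaced by $k$, $\nu$ by $\boldsymbol\nu_k$, $\ell$ by $(\ell'_1,\ldots,\ell'_{k+1})$ and $N$ by $N'$; in the claim $\ell'_{k+1}=|\boldsymbol\ell^{k+1}|-2|\boldsymbol\nu^{k+1}|$ and $N'=N-|\boldsymbol\nu^{k+1}|$.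 *)

theory Defs
  imports Complex_Main
begin

text \<open>
  A vector of length \<open>m\<close> is a function on \<open>nat\<close> of which only the entries at positions
  \<open>1..m\<close> are used.  The indices \<open>\<nu>\<close> are integer valued because the shift operators may
  leave the non-negative range; \<open>l\<close> and \<open>N\<close> are integers so that subtraction does not
  truncate.
\<close>

definition tail_sum :: "nat \<Rightarrow> (nat \<Rightarrow> int) \<Rightarrow> nat \<Rightarrow> int"
  where "tail_sum m v i = (\<Sum>j\<in>{i..m}. v j)"

text \<open>\<open>|\<nu>\<^sup>i|\<close> is \<open>tail_sum d \<nu> i\<close> and \<open>|l\<^sup>i|\<close> is \<open>tail_sum (d + 1) l i\<close>.\<close>

definition aa :: "nat \<Rightarrow> (nat \<Rightarrow> int) \<Rightarrow> (nat \<Rightarrow> int) \<Rightarrow> nat \<Rightarrow> int"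
  where "aa d \<nu> l j = tail_sum (d + 1) l (j + 1) - 2 * tail_sum d \<nu> (j + 1)"

definition nonneg_index :: "nat \<Rightarrow> (nat \<Rightarrow> int) \<Rightarrow> bool"
  where "nonneg_index d \<nu> \<longleftrightarrow> (\<forall>j\<in>{1..d}. 0 \<le> \<nu> j)"

definition H_set :: "nat \<Rightarrow> (nat \<Rightarrow> int) \<Rightarrow> int \<Rightarrow> (nat \<Rightarrow> int) set"
  where "H_set d l N =
    {\<nu>. nonneg_index d \<nu> \<and>
        tail_sum d \<nu> 1 \<le> N \<and>
        tail_sum d \<nu> 1 \<le> tail_sum (d + 1) l 1 - N \<and>
        (\<forall>j\<in>{1..d}. \<nu> j \<le> l j \<and> \<nu> j \<le> aa d \<nu> l j)}"

definition hahn_Q :: "nat \<Rightarrow> real \<Rightarrow> real \<Rightarrow> real \<Rightarrow> real \<Rightarrow> real"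
  where "hahn_Q n t a b M =
    (\<Sum>k\<le>n. pochhammer (- real n) k * pochhammer (real n - a - b - 1) k * pochhammer (- t) k /
            (pochhammer (- a) k * pochhammer (- M) k * fact k))"

text \<open>
  The product \<open>(-M)\<^sub>n Q\<^sub>n(t; a, b, M)\<close>, with \<open>(-M)\<^sub>n / (-M)\<^sub>k\<close> replaced by
  \<open>(-M + k)\<^sub>n\<^sub>-\<^sub>k\<close>.  In the multivariate polynomials \<open>M\<close> depends on \<open>x\<close>, and this form is
  polynomial in \<open>x\<close> also where \<open>(-M)\<^sub>k\<close> vanishes.
\<close>

definition hahn_Q_poly :: "nat \<Rightarrow> real \<Rightarrow> real \<Rightarrow> real \<Rightarrow> real \<Rightarrow> real"
  where "hahn_Q_poly n t a b M =
    (\<Sum>k\<le>n. pochhammer (- real n) k * pochhammer (real n - a - b - 1) k * pochhammer (- t) k *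
            pochhammer (- M + real k) (n - k) / (pochhammer (- a) k * fact k))"

lemma hahn_Q_poly_eq:
  assumes "pochhammer (- M) n \<noteq> 0"
  shows "hahn_Q_poly n t a b M = pochhammer (- M) n * hahn_Q n t a b M"
proof -
  have "pochhammer (real k - M) (n - k) = pochhammer (- M) n / pochhammer (- M) k" if "k \<le> n" for k
    using assms pochhammer_product[OF that, of "- M"] by (auto simp: add.commute)
  then show ?thesis
    unfolding hahn_Q_poly_def hahn_Q_def sum_distrib_left
    by (intro sum.cong) (simp_all add: mult_ac)
qed

definition NN :: "nat \<Rightarrow> (nat \<Rightarrow> int) \<Rightarrow> int \<Rightarrow> (nat \<Rightarrow> real) \<Rightarrow> nat \<Rightarrow> real"
  where "NN d \<nu> N x j = of_int N - (\<Sum>i\<in>{1..<j}. x i) - of_int (tail_sum d \<nu> (j + 1))"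

text \<open>
  Polynomials with a negative index are set to 0.  In the difference equations they only occur
  with coefficient zero, so this choice is immaterial.
\<close>

definition Q_hat :: "nat \<Rightarrow> (nat \<Rightarrow> int) \<Rightarrow> int \<Rightarrow> (nat \<Rightarrow> real) \<Rightarrow> (nat \<Rightarrow> int) \<Rightarrow> real"
  where "Q_hat d l N x \<nu> =
    (if nonneg_index d \<nu> then
       1 / pochhammer (- of_int N) (nat (tail_sum d \<nu> 1)) *
       (\<Prod>j\<in>{1..d}. hahn_Q_poly (nat (\<nu> j)) (x j) (of_int (l j)) (of_int (aa d \<nu> l j))
                                (NN d \<nu> N x j))
     else 0)"

lemma Q_hat_eq:
  assumes "nonneg_index d \<nu>"
    and "\<And>j. j \<in> {1..d} \<Longrightarrow> pochhammer (- NN d \<nu> N x j) (nat (\<nu> j)) \<noteq> 0"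
  shows "Q_hat d l N x \<nu> =
    1 / pochhammer (- of_int N) (nat (tail_sum d \<nu> 1)) *
    (\<Prod>j\<in>{1..d}. pochhammer (- NN d \<nu> N x j) (nat (\<nu> j)) *
      hahn_Q (nat (\<nu> j)) (x j) (of_int (l j)) (of_int (aa d \<nu> l j)) (NN d \<nu> N x j))"
  using assms by (simp add: Q_hat_def hahn_Q_poly_eq)

text \<open>\<open>B_coeff d \<nu> l N i s t\<close> is the coefficient \<open>B\<^sub>i\<close> with superscripts \<open>s, t \<in> {-1, 0, 1}\<close>;
  for \<open>i = 0\<close> only \<open>s = 0\<close> occurs.\<close>

definition B_coeff ::
  "nat \<Rightarrow> (nat \<Rightarrow> int) \<Rightarrow> (nat \<Rightarrow> int) \<Rightarrow> int \<Rightarrow> nat \<Rightarrow> int \<Rightarrow> int \<Rightarrow> real"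
  where "B_coeff d \<nu> l N i s t =
   (let v = real_of_int (\<nu> i);
        li = real_of_int (l i);
        n0 = real_of_int (tail_sum d \<nu> i);
        n1 = real_of_int (tail_sum d \<nu> (i + 1));
        L0 = real_of_int (tail_sum (d + 1) l i);
        L1 = real_of_int (tail_sum (d + 1) l (i + 1))
    in if i = 0 then
         (if t = 0 then - of_int N + L1 / 2
          else if t = 1 then of_int N - n1
          else n1 - L1 + of_int N - 1)
       else if s = 0 \<and> t = 0 then
         n0 * (n0 - L0 - 1) + n1 * (n1 - L1 - 1) + 1 / 2 * L1 * (L0 + 2)
       else if s = 0 \<and> t = 1 then - v * (v + 2 * n1 - L0 - 1)
       else if s = 0 \<and> t = -1 then (li - v) * (v + 2 * n1 - L1 - 1)
       else if s = 1 \<and> t = 0 then (li - v) * (v + 2 * n1 - L0 - 1)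
       else if s = -1 \<and> t = 0 then - v * (v + 2 * n1 - L1 - 1)
       else if s = 1 \<and> t = 1 then (v + 2 * n1 - L0 - 1) * (v + 2 * n1 - L0)
       else if s = -1 \<and> t = 1 then v * (v - 1)
       else if s = 1 \<and> t = -1 then (li - v) * (li - v - 1)
       else (v + 2 * n1 - L1 - 1) * (v + 2 * n1 - L1 - 2))"

definition b_coeff :: "nat \<Rightarrow> (nat \<Rightarrow> int) \<Rightarrow> (nat \<Rightarrow> int) \<Rightarrow> nat \<Rightarrow> int \<Rightarrow> real"
  where "b_coeff d \<nu> l i s =
   (let w = 2 * real_of_int (tail_sum d \<nu> i) - real_of_int (tail_sum (d + 1) l i)
    in if s = 0 then 1 / 2 * w * (w - 2)
       else if s = 1 then w * (w - 1)
       else (w - 2) * (w - 1))"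

text \<open>The set \<open>{-1, 0, 1}\<^sup>d\<close>; entries outside \<open>1..d\<close> are 0, which encodes
  \<open>\<mu>\<^sub>0 = \<mu>\<^sub>d\<^sub>+\<^sub>1 = 0\<close>.\<close>

definition signs :: "nat \<Rightarrow> (nat \<Rightarrow> int) set"
  where "signs d = {\<mu>. (\<forall>j\<in>{1..d}. \<mu> j \<in> {-1, 0, 1}) \<and> (\<forall>j. j \<notin> {1..d} \<longrightarrow> \<mu> j = 0)}"

lemma finite_signs: "finite (signs d)"
  unfolding signs_def using finite_set_of_finite_funs[of "{1..d}" "{-1, 0, 1::int}" 0]
  by (rule rev_finite_subset) auto

definition C_coeff ::
  "nat \<Rightarrow> (nat \<Rightarrow> int) \<Rightarrow> (nat \<Rightarrow> int) \<Rightarrow> int \<Rightarrow> (nat \<Rightarrow> int) \<Rightarrow> real"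
  where "C_coeff d \<nu> l N \<mu> =
    (\<Prod>k\<in>{0..d}. B_coeff d \<nu> l N k (\<mu> k) (\<mu> (k + 1))) / (\<Prod>k\<in>{1..d}. b_coeff d \<nu> l k (\<mu> k))"

text \<open>The effect on \<open>\<nu>\<close> of the product of the shifts of \<open>\<nu>\<^sub>k\<close> by \<open>\<mu>\<^sub>k - \<mu>\<^sub>k\<^sub>+\<^sub>1\<close>,
  \<open>1 \<le> k \<le> d\<close>.\<close>

definition shift :: "nat \<Rightarrow> (nat \<Rightarrow> int) \<Rightarrow> (nat \<Rightarrow> int) \<Rightarrow> nat \<Rightarrow> int"
  where "shift d \<mu> \<nu> = (\<lambda>j. if j \<in> {1..d} then \<nu> j + (\<mu> j - \<mu> (j + 1)) else \<nu> j)"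

text \<open>
  The value at \<open>\<nu>\<close> of the operator \<open>L\<^sub>d(\<nu>; l; N)\<close> applied to \<open>f\<close>.  Its coefficients depend only
  on the first \<open>d\<close> entries of \<open>\<nu>\<close> and only these are shifted, so it also acts on functions of
  longer multi-indices.
\<close>

definition L_gen ::
  "nat \<Rightarrow> (nat \<Rightarrow> int) \<Rightarrow> int \<Rightarrow> ((nat \<Rightarrow> int) \<Rightarrow> real) \<Rightarrow> (nat \<Rightarrow> int) \<Rightarrow> real"
  where "L_gen d l N f \<nu> =
    (\<Sum>\<mu>\<in>signs d - {\<lambda>_. 0}. C_coeff d \<nu> l N \<mu> * (f (shift d \<mu> \<nu>) - f \<nu>))"

definition ell_red :: "nat \<Rightarrow> (nat \<Rightarrow> int) \<Rightarrow> (nat \<Rightarrow> int) \<Rightarrow> nat \<Rightarrow> nat \<Rightarrow> int"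
  where "ell_red d \<nu> l k =
    (\<lambda>j. if j = k + 1 then tail_sum (d + 1) l (k + 1) - 2 * tail_sum d \<nu> (k + 1) else l j)"

definition N_red :: "nat \<Rightarrow> (nat \<Rightarrow> int) \<Rightarrow> int \<Rightarrow> nat \<Rightarrow> int"
  where "N_red d \<nu> N k = N - tail_sum d \<nu> (k + 1)"

definition L_op ::
  "nat \<Rightarrow> (nat \<Rightarrow> int) \<Rightarrow> int \<Rightarrow> nat \<Rightarrow> ((nat \<Rightarrow> int) \<Rightarrow> real) \<Rightarrow> (nat \<Rightarrow> int) \<Rightarrow> real"
  where "L_op d l N k f \<nu> = L_gen k (ell_red d \<nu> l k) (N_red d \<nu> N k) f \<nu>"

lemma ell_red_top: "ell_red d \<nu> l d = l"
  by (auto simp: ell_red_def tail_sum_def)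

lemma L_op_top: "L_op d l N d f \<nu> = L_gen d l N f \<nu>"
  by (simp add: L_op_def ell_red_top N_red_def tail_sum_def)

text \<open>
  The \<open>\<nu>\<close> for which every polynomial in \<open>L\<^sub>k\<close> applied to the polynomial of index \<open>\<nu>\<close>, apart
  from those with a negative index, has its index in \<open>H_set\<close>.  Membership of the shifted
  indices makes all denominators of the coefficients non-zero.
\<close>

definition admissible :: "nat \<Rightarrow> (nat \<Rightarrow> int) \<Rightarrow> int \<Rightarrow> nat \<Rightarrow> (nat \<Rightarrow> int) \<Rightarrow> bool"
  where "admissible d l N k \<nu> \<longleftrightarrow>
    \<nu> \<in> H_set d l N \<and>
    (\<forall>\<mu>\<in>signs k - {\<lambda>_. 0}. nonneg_index d (shift k \<mu> \<nu>) \<longrightarrow> shift k \<mu> \<nu> \<in> H_set d l N)"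

end

theory Submission
  imports Defs
begin

text \<open>
  In terms of the tail sums \<open>n\<^sub>i = |\<nu>\<^sup>i|\<close> the shift by \<open>\<mu>\<close> is \<open>n\<^sub>i \<mapsto> n\<^sub>i + \<mu>\<^sub>i\<close>, the coefficient
  \<open>C\<^sub>\<mu>\<close> is a product of factors depending on \<open>(\<mu>\<^sub>i, \<mu>\<^sub>i\<^sub>+\<^sub>1)\<close>, and the \<open>i\<close>-th factor of the
  Hahn polynomial depends only on \<open>(n\<^sub>i, n\<^sub>i\<^sub>+\<^sub>1)\<close>.  So the sum over \<open>\<mu>\<close> is a product of
  transfer matrices and can be evaluated one coordinate at a time.  Three relations between
  contiguous univariate Hahn polynomials (one for each value of \<open>\<mu>\<^sub>i\<^sub>+\<^sub>1\<close>) say that summing over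
  \<open>\<mu>\<^sub>i\<close> reproduces the boundary vector \<open>B\<^sub>0\<close>, with \<open>N\<close> replaced by \<open>N - x\<^sub>1 - \<dots> - x\<^sub>i\<close> and
  \<open>|l|\<close> by \<open>|l\<^sup>i\<^sup>+\<^sup>1|\<close>.  At the end this gives the eigenvalue \<open>|x| - N + l\<^sub>d\<^sub>+\<^sub>1 / 2\<close> for the full
  sum, and evaluation at \<open>x = 0\<close>, where every normalized polynomial is 1, gives
  \<open>\<Sum> C\<^sub>\<mu> = - N + l\<^sub>d\<^sub>+\<^sub>1 / 2\<close>; the difference is \<open>|x|\<close>.  The operators with \<open>k < d\<close> reduce to this
  case because the factors of index larger than \<open>k\<close> are not shifted.
\<close>

subsection \<open>Coefficient identities\<close>

text \<open>Comparison of the \<open>k\<close>-th coefficients in the relation for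
  \<open>t = 1\<close>, with \<open>v\<close> the degree, \<open>c = v - l - b - 1\<close> and
  \<open>y = - M\<close>. The three denominators are those of the operator at
  \<open>w = v + c + 1\<close>.\<close>

lemma coeff_identity_up:
  fixes v c y k :: real
  assumes "v + c + 1 \<noteq> 0" "v + c \<noteq> 0" "v + c - 1 \<noteq> 0"
  shows "- ((c+k)*(c+k+1)*(y+v)) / ((v+c+1)*(v+c)) - (y+(v-c-1)/2)*(v-k)*(c+k) / (1/2*(v+c+1)*(v+c-1))
     + (c-y)*(v-k)*(v-1-k)/((v+c-1)*(v+c)) = -(y+k)"
  using assms by (simp add: divide_simps) algebra

text \<open>The same comparison for \<open>t = 0\<close>, over the common base
  \<open>(-v-1)_k (c-1)_k\<close>. The last summand on the right comes from the shifted terms that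
  multiplication by \<open>x\<close> produces.\<close>

lemma coeff_identity_0:
  fixes v c y k l :: real
  assumes "v + c + 1 \<noteq> 0" "v + c \<noteq> 0" "v + c - 1 \<noteq> 0" "v + 1 \<noteq> 0" "c - 1 \<noteq> 0"
  shows "(y+v)*(v-l)*(c+k)*((c-1+k)/(c-1)) / ((v+c+1)*(v+c))
     + (y+(v-c-1)/2)*(v*c+(v-l-c-1)*(v-c+1)/2) *((v+1-k)*(c-1+k)/((v+1)*(c-1)))/ (1/2*(v+c+1)*(v+c-1))
     - (c-y)*(c+l)*((v-k)*(v+1-k)/(v+1))/((v+c-1)*(v+c)) =
   (y+(v-l-c-1)/2+k)*((v+1-k)*(c-1+k)/((v+1)*(c-1))) + k*(k-1-l)*(y+k-1)/((v+1)*(c-1))"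
  using assms by (simp add: divide_simps) algebra

text \<open>The left-hand side of \<open>coeff_identity_down\<close> below is affine in \<open>y\<close>.  Its slope and its value at
  \<open>y = - v\<close> are treated separately, to keep the polynomial identities small.\<close>

lemma coeff_identity_down_slope:
  fixes v c k l :: real
  assumes "v + c + 1 \<noteq> 0" "v + c \<noteq> 0" "v + c - 1 \<noteq> 0" "v + 1 \<noteq> 0" "c - 1 \<noteq> 0" "v + 2 \<noteq> 0" "c - 2 \<noteq> 0"
  shows "(v-l)*(v+1-l)*((c-2+k)*(c-1+k)/((c-2)*(c-1))) / ((v+c+1)*(v+c))
     + (c+l)*(v-l)*((v+2-k)*(c-2+k)/((v+2)*(c-2)))/ (1/2*(v+c+1)*(v+c-1))
     + (c+l)*(c+l-1)*((v+2-k)*(v+1-k)/((v+2)*(v+1)))/((v+c-1)*(v+c)) =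
   ((v+2-k)*(v+1-k)*(c-2+k)*(c-1+k) + 2*k*(k-1-l)*(v+2-k)*(c-2+k)
    + k*(k-1)*(k-1-l)*(k-2-l)) / ((v+2)*(v+1)*(c-2)*(c-1))"
  using assms by (simp add: divide_simps) algebra

lemma coeff_identity_down_value:
  fixes v c k l :: real
  assumes  "v + c - 1 \<noteq> 0" "v + 1 \<noteq> 0" "c - 1 \<noteq> 0" "v + 2 \<noteq> 0" "c - 2 \<noteq> 0"
  shows "(c+l)*(v-l)*((v+2-k)*(c-2+k)/((v+2)*(c-2))) / (v+c-1)
     + (c+l)*(c+l-1)*((v+2-k)*(v+1-k)/((v+2)*(v+1)))/(v+c-1) =
   (- (k-l-c)*((v+2-k)*(v+1-k)*(c-2+k)*(c-1+k))
    - (-v-l-c-1+2*k-1)*k*(k-1-l)*(v+2-k)*(c-2+k)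
    - k*(k-1)*(k-1-l)*(k-2-l)*(-v+k-2)) / ((v+2)*(v+1)*(c-2)*(c-1))"
  using assms by (simp add: divide_simps) algebra

lemma coeff_identity_down:
  fixes v c y k l :: real
  assumes w: "v + c + 1 \<noteq> 0" "v + c \<noteq> 0" "v + c - 1 \<noteq> 0"
    and nz: "v + 1 \<noteq> 0" "c - 1 \<noteq> 0" "v + 2 \<noteq> 0" "c - 2 \<noteq> 0"
  shows "- ((y+v)*(v-l)*(v+1-l)*((c-2+k)*(c-1+k)/((c-2)*(c-1)))) / ((v+c+1)*(v+c))
     - (y+(v-c-1)/2)*(c+l)*(v-l)*((v+2-k)*(c-2+k)/((v+2)*(c-2)))/ (1/2*(v+c+1)*(v+c-1))
     + (c-y)*(c+l)*(c+l-1)*((v+2-k)*(v+1-k)/((v+2)*(v+1)))/((v+c-1)*(v+c)) =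
   (- (k+v-l-c+y)*((v+2-k)*(v+1-k)*(c-2+k)*(c-1+k))
    - (v-l-c-1+2*y+2*k-1)*k*(k-1-l)*(v+2-k)*(c-2+k)
    - k*(k-1)*(k-1-l)*(k-2-l)*(y+k-2)) / ((v+2)*(v+1)*(c-2)*(c-1))" (is "?lhs = ?rhs")
proof -
  define P1 where "P1 = (v-l)*(v+1-l)*((c-2+k)*(c-1+k)/((c-2)*(c-1)))"
  define P0 where "P0 = (c+l)*(v-l)*((v+2-k)*(c-2+k)/((v+2)*(c-2)))"
  define Pm where "Pm = (c+l)*(c+l-1)*((v+2-k)*(v+1-k)/((v+2)*(v+1)))"
  define D where "D = (v+2)*(v+1)*(c-2)*(c-1)"
  have "?lhs = - ((y+v)*P1) / ((v+c+1)*(v+c)) - (y+(v-c-1)/2)*P0/ (1/2*(v+c+1)*(v+c-1))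
     + (c-y)*Pm/((v+c-1)*(v+c))"
    by (simp add: P1_def P0_def Pm_def mult.assoc)
  \<comment> \<open>\<open>y + (v-c-1)/2 = (y+v) - (v+c+1)/2\<close> and
    \<open>c - y = (v+c) - (y+v)\<close> separate slope and value.\<close>
  also have "\<dots> = - (y+v) * (P1 / ((v+c+1)*(v+c)) + P0 / (1/2*(v+c+1)*(v+c-1)) + Pm/((v+c-1)*(v+c)))
      + (P0 / (v+c-1) + Pm / (v+c-1))"
    using w by (simp add: divide_simps) algebra
  also have "\<dots> = ?rhs"
    unfolding P1_def P0_def Pm_def coeff_identity_down_slope[OF w nz]
      coeff_identity_down_value[OF w(3) nz] unfolding D_def[symmetric]
      times_divide_eq_right add_divide_distrib[symmetric]
    by (rule arg_cong[where f = "\<lambda>u. u / D"]) algebra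
  finally show ?thesis .
qed

subsection \<open>Contiguous relations for univariate Hahn polynomials\<close>

text \<open>With \<open>y = - M\<close>, the product of \<open>hahn_Q_poly v x l b M\<close> and \<open>(-l)\<^sub>v\<close> as a polynomial in all
  of \<open>x\<close>, \<open>l\<close>, \<open>b\<close>, \<open>y\<close>, so that relations may be proved for generic parameters only.\<close>

definition hahn_R :: "int \<Rightarrow> real \<Rightarrow> real \<Rightarrow> real \<Rightarrow> real \<Rightarrow> real"
  where "hahn_R v x l b y =
    (if v < 0 then 0 else
       \<Sum>k\<le>nat v. pochhammer (- of_int v) k * pochhammer (of_int v - l - b - 1) k * pochhammer (- x) k *
         pochhammer (y + real k) (nat v - k) * pochhammer (- l + real k) (nat v - k) / fact k)"

lemma pochhammer_step: "z * pochhammer (z + 1) k = (z + real k) * pochhammer (z :: real) k"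
  by (metis pochhammer_rec pochhammer_rec')

lemma pochhammer_shift:
  "z \<noteq> 0 \<Longrightarrow> w = z + 1 \<Longrightarrow> pochhammer w k = pochhammer z k * ((z + real k) / (z :: real))"
  using pochhammer_step[of z k] by (simp add: field_simps)

lemma pochhammer_shift_neg:
  "z \<noteq> 0 \<Longrightarrow> u = - z \<Longrightarrow> w = 1 - z \<Longrightarrow> pochhammer w k = pochhammer u k * ((z - real k) / (z :: real))"
proof -
  assume z: "z \<noteq> 0" "u = - z" "w = 1 - z"
  then have "(u + real k) / u = (z - real k) / z"
    by (simp add: field_simps)
  then show "pochhammer w k = pochhammer u k * ((z - real k) / z)"
    using pochhammer_shift[of u w k] z by simp
qed

lemma eq_mult_divideI: "q \<noteq> 0 \<Longrightarrow> h * X = q * u \<Longrightarrow> u = h * (X / (q :: real))"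
  by (simp add: field_simps)

lemma pochhammer_nonint: "(z :: real) \<notin> \<int> \<Longrightarrow> pochhammer z k \<noteq> 0"
  by (auto simp: pochhammer_eq_0_iff)

text \<open>Without zeros, \<open>(y+k)_(n-k) = (y)_n / (y)_k\<close>, and likewise for
  \<open>- l\<close>, which restores the hypergeometric form. The variables \<open>v\<close>,
  \<open>\<alpha>\<close>, \<open>\<gamma>\<close> are separate so that the rule fits degrees and
  bases written in any form.\<close>

lemma hahn_R_generic:
  assumes y: "y \<notin> \<int>" and l: "l \<notin> \<int>" and "n \<le> K"
    and v: "v = int n" and \<alpha>: "\<alpha> = - real n" and \<gamma>: "\<gamma> = real n - l - b - 1"
  shows "hahn_R v x l b y = pochhammer y n * pochhammer (- l) n *
    (\<Sum>k\<le>K. pochhammer \<alpha> k * pochhammer \<gamma> k *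
      (pochhammer (- x) k / (pochhammer y k * pochhammer (- l) k * fact k)))"
proof -
  have nz: "pochhammer y k \<noteq> 0" "pochhammer (- l) k \<noteq> 0" for k
    using pochhammer_nonint[OF y] pochhammer_nonint[of "- l"] l by auto
  have "(\<Sum>k\<le>K. pochhammer (- real n) k * pochhammer (real n - l - b - 1) k *
      (pochhammer (- x) k / (pochhammer y k * pochhammer (- l) k * fact k))) =
    (\<Sum>k\<le>n. pochhammer (- real n) k * pochhammer (real n - l - b - 1) k *
      (pochhammer (- x) k / (pochhammer y k * pochhammer (- l) k * fact k)))"
    using \<open>n \<le> K\<close> by (intro sum.mono_neutral_right) (auto simp: pochhammer_of_nat_eq_0_lemma)
  moreover have "pochhammer (- real n) k * pochhammer (real n - l - b - 1) k * pochhammer (- x) k *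
         pochhammer (y + real k) (n - k) * pochhammer (- l + real k) (n - k) / fact k =
     pochhammer y n * pochhammer (- l) n * (pochhammer (- real n) k * pochhammer (real n - l - b - 1) k *
      (pochhammer (- x) k / (pochhammer y k * pochhammer (- l) k * fact k)))" if "k \<le> n" for k
    using pochhammer_product[OF that, of y] pochhammer_product[OF that, of "- l"] nz[of k]
    by simp
  ultimately show ?thesis
    by (simp add: hahn_R_def sum_distrib_left v \<alpha> \<gamma>)
qed

text \<open>For \<open>y\<close> and \<open>l\<close> not integral no Pochhammer symbol in a denominator vanishes, and the
  polynomials can be compared term by term.  The summation bound \<open>K\<close> is common to all of
  them; the additional terms are zero.\<close>

context
  fixes n K :: nat and x l b y c :: real and E :: "nat \<Rightarrow> real" and D :: real
  assumes y: "y \<notin> \<int>" and l: "l \<notin> \<int>" and c: "c = real n - l - b - 1" and neg: "real n + c + 1 < 0" and K: "n + 2 \<le> K"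
    and E: "E = (\<lambda>k. pochhammer (- x) k / (pochhammer y k * pochhammer (- l) k * fact k))"
    and D: "D = pochhammer y n * pochhammer (- l) n"
begin

lemma nonint_shift: "y + 1 \<notin> \<int>" "y - 1 \<notin> \<int>"
proof -
  show "y + 1 \<notin> \<int>" using y Ints_diff[of "y + 1" 1] by auto
  show "y - 1 \<notin> \<int>" using y Ints_add[of "y - 1" 1] by auto
qed

lemma nonint_nonzero: "y \<noteq> 0" "y - 1 \<noteq> 0"
  using y by auto

lemma nonint_add_nonzero: "y + real k \<noteq> 0" "real k - l \<noteq> 0" "l \<noteq> real k"
proof -
  show "y + real k \<noteq> 0"
  proof
    assume "y + real k = 0"
    then have "y = - real k" by simp
    then show False using y by auto
  qed
  show "l \<noteq> real k" using l by auto
  then show "real k - l \<noteq> 0" by auto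
qed

text \<open>Consecutive weights differ by one factor of each Pochhammer symbol. This recurrence
  trades multiplication by \<open>x\<close> for a shift of \<open>k\<close>.\<close>

lemma weight_Suc: "E (Suc k) * (real k + 1) * (real k - l) * (y + real k) = (real k - x) * E k"
  using nonint_add_nonzero[of k] nonint_nonzero pochhammer_nonint[OF y, of k] pochhammer_nonint[of "- l" k] l
  unfolding E by (simp add: pochhammer_Suc divide_simps)

text \<open>Moving \<open>y\<close> by one changes a weight only by a rational factor in
  \<open>k\<close>, so the polynomials for \<open>t = 1\<close> and \<open>t = -1\<close> can also
  be expanded over \<open>E\<close>.\<close>

lemma weight_up: "E k / (y + real k) * y = pochhammer (- x) k / (pochhammer (y+1) k * pochhammer (- l) k * fact k)"
  using nonint_add_nonzero[of k] nonint_nonzero pochhammer_step[of y k] pochhammer_nonint[OF y, of k] pochhammer_nonint[OF nonint_shift(1), of k]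
  unfolding E by (simp add: divide_simps mult_ac)

lemma weight_down: "(y - 1 + real k) * E k = (y - 1) * (pochhammer (- x) k / (pochhammer (y-1) k * pochhammer (- l) k * fact k))"
  using nonint_add_nonzero[of k] nonint_nonzero pochhammer_step[of "y-1" k] pochhammer_nonint[OF y, of k] pochhammer_nonint[OF nonint_shift(2), of k]
  unfolding E by (simp add: divide_simps mult_ac)

section \<open>Expansion of the nine shifted polynomials over common weights\<close>

lemma hahn_R_same: "hahn_R (int n) x l b y = D * (\<Sum>k\<le>K. pochhammer (- real n) k * pochhammer c k * E k)"
  unfolding D E by (rule hahn_R_generic) (use y l K c in auto)

text \<open>In these names \<open>same\<close>, \<open>up\<close>, \<open>down\<close> stand for
  \<open>t = 0, 1, -1\<close> and \<open>plus\<close>, \<open>0\<close>, \<open>minus\<close> for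
  \<open>s = 1, 0, -1\<close>. The degree is \<open>n + s - t\<close>, so the bases are
  \<open>- n - s + t\<close> and \<open>c + s + t\<close>, before any rewriting.\<close>

lemma hahn_R_same_plus: "hahn_R (int n + 1) x l b y =
   D * (y + real n) * (real n - l) * (\<Sum>k\<le>K. pochhammer (- real n - 1) k * pochhammer (c+1) k * E k)"
proof -
  have "hahn_R (int n + 1) x l b y = pochhammer y (Suc n) * pochhammer (- l) (Suc n) *
    (\<Sum>k\<le>K. pochhammer (- real n - 1) k * pochhammer (c+1) k * E k)"
    unfolding E by (rule hahn_R_generic) (use y l K c in auto)
  then show ?thesis unfolding D by (simp add: pochhammer_Suc algebra_simps)
qed

text \<open>\<open>(n-k) (-n)_k = n (1-n)_k\<close> lowers the degree while keeping the base
  \<open>- n\<close>. The factor \<open>n\<close> on the left also covers \<open>n = 0\<close>,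
  where the index is negative and both sides vanish.\<close>

lemma hahn_R_same_minus: "real n * (real n - 1 - l) * (y + real n - 1) * hahn_R (int n - 1) x l b y =
   D * (\<Sum>k\<le>K. (real n - real k) * pochhammer (- real n) k * pochhammer (c-1) k * E k)"
proof (cases n)
  case 0
  then show ?thesis by (auto intro!: sum.neutral simp: pochhammer_0_left)
next
  case (Suc m)
  have *: "(real n - real k) * pochhammer (- real n) k = real n * pochhammer (- real m) k" for k
    using pochhammer_step[of "- real n" k] Suc by (simp add: algebra_simps)
  have 1: "D = pochhammer y m * (y + real n - 1) * ((real n - 1 - l) * pochhammer (- l) m)"
    unfolding D Suc by (simp add: pochhammer_Suc)
  have "hahn_R (int n - 1) x l b y = pochhammer y m * pochhammer (- l) m *
    (\<Sum>k\<le>K. pochhammer (- real m) k * pochhammer (c-1) k * E k)"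
    unfolding E by (rule hahn_R_generic) (use y l K c Suc in auto)
  then show ?thesis
    unfolding * 1 by (simp add: sum_distrib_left mult_ac)
qed

lemma hahn_R_up_plus: "hahn_R (int n) x l (b - 2) (y + 1) =
   D * (y + real n) * (\<Sum>k\<le>K. pochhammer (- real n) k * pochhammer (c+2) k * (E k / (y + real k)))"
proof -
  have 1: "pochhammer (y+1) n * y = pochhammer y n * (y + real n)"
    using pochhammer_step[of y n] by (simp add: mult_ac)
  have "hahn_R (int n) x l (b - 2) (y + 1) = pochhammer (y+1) n * pochhammer (- l) n *
     (\<Sum>k\<le>K. pochhammer (- real n) k * pochhammer (c+2) k * (E k / (y + real k) * y))"
    unfolding weight_up by (rule hahn_R_generic) (use nonint_shift l K c in auto)
  also have "\<dots> = (pochhammer (y+1) n * y) * pochhammer (- l) n *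
     (\<Sum>k\<le>K. pochhammer (- real n) k * pochhammer (c+2) k * (E k / (y + real k)))"
    by (simp add: sum_distrib_left mult_ac)
  finally show ?thesis unfolding 1 D by (simp add: mult_ac)
qed

lemma hahn_R_up_0: "real n * (real n - 1 - l) * hahn_R (int n - 1) x l (b - 2) (y + 1) =
   D * (\<Sum>k\<le>K. (real n - real k) * pochhammer (- real n) k * pochhammer (c+1) k * (E k / (y + real k)))"
proof (cases n)
  case 0
  then show ?thesis by (auto intro!: sum.neutral simp: pochhammer_0_left)
next
  case (Suc m)
  have *: "(real n - real k) * pochhammer (- real n) k = real n * pochhammer (- real m) k" for k
    using pochhammer_step[of "- real n" k] Suc by (simp add: algebra_simps)
  have 1: "D = y * pochhammer (y+1) m * ((real n - 1 - l) * pochhammer (- l) m)"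
    unfolding D Suc by (simp only: pochhammer_rec[of y] pochhammer_rec'[of "-l"]) simp
  have "hahn_R (int n - 1) x l (b - 2) (y + 1) = pochhammer (y+1) m * pochhammer (- l) m *
     (\<Sum>k\<le>K. pochhammer (- real m) k * pochhammer (c+1) k * (E k / (y + real k) * y))"
    unfolding weight_up by (rule hahn_R_generic) (use nonint_shift l K c Suc in auto)
  also have "\<dots> = pochhammer (y+1) m * y * pochhammer (- l) m *
     (\<Sum>k\<le>K. pochhammer (- real m) k * pochhammer (c+1) k * (E k / (y + real k)))"
    by (simp add: sum_distrib_left mult_ac)
  finally show ?thesis unfolding * 1 using Suc by (simp add: sum_distrib_left mult_ac)
qed

lemma hahn_R_up_minus: "real n * (real n - 1) * (real n - 1 - l) * (real n - 2 - l) * (y + real n - 1) *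
     hahn_R (int n - 2) x l (b - 2) (y + 1) =
   D * (\<Sum>k\<le>K. (real n - real k) * (real n - 1 - real k) * pochhammer (- real n) k * pochhammer c k * (E k / (y + real k)))"
proof (cases "n < 2")
  case True
  then consider "n = 0" | "n = 1" by linarith
  then show ?thesis
  proof cases
    case 2
    \<comment> \<open>\<open>(-1)_k\<close> vanishes for \<open>k > 1\<close>, and the two linear
      factors remove \<open>k = 0\<close> and \<open>k = 1\<close>.\<close>
    have "(real n - real k) * (real n - 1 - real k) * pochhammer (- real n) k = 0" for k
      using pochhammer_of_nat_eq_0_lemma[of 1 k, where 'a = real] 2 by (cases "k \<le> 1") (auto simp: le_Suc_eq)
    then show ?thesis using 2 by (simp del: mult_eq_0_iff add: sum.neutral)
  qed (auto intro!: sum.neutral simp: pochhammer_0_left)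
next
  case False
  define m where "m = n - 2"
  have m: "n = Suc (Suc m)" using False by (simp add: m_def)
  have *: "(real n - real k) * (real n - 1 - real k) * pochhammer (- real n) k =
     real n * (real n - 1) * pochhammer (- real m) k" for k
  proof -
    have "(real n - real k) * pochhammer (- real n) k = real n * pochhammer (- real n + 1) k"
      using pochhammer_step[of "- real n" k] by (simp add: algebra_simps)
    moreover have "(real n - 1 - real k) * pochhammer (- real n + 1) k = (real n - 1) * pochhammer (- real m) k"
      using pochhammer_step[of "- real n + 1" k] m by (simp add: algebra_simps)
    ultimately show ?thesis by algebra
  qed
  have 1: "D = y * (pochhammer (y+1) m * (y + real n - 1)) * ((real n - 1 - l) * ((real n - 2 - l) * pochhammer (- l) m))"
    unfolding D m by (simp only: pochhammer_rec[of y] pochhammer_rec'[of "-l"] pochhammer_Suc[of "y+1"])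
       (simp add: algebra_simps)
  have "hahn_R (int n - 2) x l (b - 2) (y + 1) = pochhammer (y+1) m * pochhammer (- l) m *
     (\<Sum>k\<le>K. pochhammer (- real m) k * pochhammer c k * (E k / (y + real k) * y))"
    unfolding weight_up by (rule hahn_R_generic) (use nonint_shift l K c m in auto)
  also have "\<dots> = pochhammer (y+1) m * y * pochhammer (- l) m *
     (\<Sum>k\<le>K. pochhammer (- real m) k * pochhammer c k * (E k / (y + real k)))"
    by (simp add: sum_distrib_left mult_ac)
  finally show ?thesis unfolding * 1 using m by (simp add: sum_distrib_left mult_ac)
qed

lemma hahn_R_down_plus: "hahn_R (int n + 2) x l (b + 2) (y - 1) =
   D * (y + real n) * (real n - l) * (real n + 1 - l) *
   (\<Sum>k\<le>K. pochhammer (- real n - 2) k * pochhammer c k * ((y - 1 + real k) * E k))"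
proof -
  have 1: "(y - 1) * D * (y + real n) * (real n - l) * (real n + 1 - l) = pochhammer (y-1) (Suc (Suc n)) * pochhammer (- l) (Suc (Suc n))"
    unfolding D by (simp only: pochhammer_rec[of "y-1"] pochhammer_rec'[of "-l"] pochhammer_Suc[of "y"])
      (simp add: pochhammer_Suc algebra_simps)
  have "hahn_R (int n + 2) x l (b + 2) (y - 1) = pochhammer (y-1) (Suc (Suc n)) * pochhammer (- l) (Suc (Suc n)) *
     (\<Sum>k\<le>K. pochhammer (- real n - 2) k * pochhammer c k * (pochhammer (- x) k / (pochhammer (y-1) k * pochhammer (- l) k * fact k)))"
    by (rule hahn_R_generic) (use nonint_shift l K c in auto)
  also have "\<dots> = D * (y + real n) * (real n - l) * (real n + 1 - l) * (\<Sum>k\<le>K. pochhammer (- real n - 2) k * pochhammer c k * ((y - 1 + real k) * E k))"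
    unfolding 1[symmetric] weight_down by (simp add: sum_distrib_left mult_ac)
  finally show ?thesis .
qed

lemma hahn_R_down_0: "hahn_R (int n + 1) x l (b + 2) (y - 1) =
   D * (real n - l) *
   (\<Sum>k\<le>K. pochhammer (- real n - 1) k * pochhammer (c - 1) k * ((y - 1 + real k) * E k))"
proof -
  have 1: "(y - 1) * D * (real n - l) = pochhammer (y-1) (Suc n) * pochhammer (- l) (Suc n)"
    unfolding D by (simp only: pochhammer_rec[of "y-1"] pochhammer_rec'[of "-l"])
      (simp add: algebra_simps)
  have "hahn_R (int n + 1) x l (b + 2) (y - 1) = pochhammer (y-1) (Suc n) * pochhammer (- l) (Suc n) *
     (\<Sum>k\<le>K. pochhammer (- real n - 1) k * pochhammer (c - 1) k * (pochhammer (- x) k / (pochhammer (y-1) k * pochhammer (- l) k * fact k)))"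
    by (rule hahn_R_generic) (use nonint_shift l K c in auto)
  also have "\<dots> = D * (real n - l) * (\<Sum>k\<le>K. pochhammer (- real n - 1) k * pochhammer (c - 1) k * ((y - 1 + real k) * E k))"
    unfolding 1[symmetric] weight_down by (simp add: sum_distrib_left mult_ac)
  finally show ?thesis .
qed

lemma hahn_R_down_minus: "(y + real n - 1) * hahn_R (int n) x l (b + 2) (y - 1) =
   D * (\<Sum>k\<le>K. pochhammer (- real n) k * pochhammer (c - 2) k * ((y - 1 + real k) * E k))"
proof -
  have 1: "(y - 1) * D = (y + real n - 1) * pochhammer (y-1) n * pochhammer (- l) n"
  proof -
    have "(y - 1) * pochhammer y n = (y + real n - 1) * pochhammer (y-1) n"
      using pochhammer_step[of "y-1" n] by (simp add: algebra_simps)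
    then show ?thesis unfolding D by simp
  qed
  have "hahn_R (int n) x l (b + 2) (y - 1) = pochhammer (y-1) n * pochhammer (- l) n *
     (\<Sum>k\<le>K. pochhammer (- real n) k * pochhammer (c - 2) k * (pochhammer (- x) k / (pochhammer (y-1) k * pochhammer (- l) k * fact k)))"
    by (rule hahn_R_generic) (use nonint_shift l K c in auto)
  then have "(y + real n - 1) * hahn_R (int n) x l (b + 2) (y - 1) = (y - 1) * D *
     (\<Sum>k\<le>K. pochhammer (- real n) k * pochhammer (c - 2) k * (pochhammer (- x) k / (pochhammer (y-1) k * pochhammer (- l) k * fact k)))"
    unfolding 1 by simp
  then show ?thesis
    unfolding weight_down by (simp add: sum_distrib_left mult_ac)
qed

section \<open>The three contiguous relations for generic parameters\<close>

lemma pochhammer_minus_nat_eq_0: "m \<ge> n + 1 \<Longrightarrow> pochhammer (- real n) m = 0"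
  by (simp add: pochhammer_of_nat_eq_0_lemma)

text \<open>Since \<open>n \<ge> 0\<close>, negativity of \<open>n + c + 1 = 2 * n - l - b\<close>
  also forces \<open>c < -1\<close>.\<close>

lemma neg_nonzero: "real n + c + 1 \<noteq> 0" "real n + c \<noteq> 0" "real n + c - 1 \<noteq> 0" "c \<noteq> 0" "c - 1 \<noteq> 0" "c - 2 \<noteq> 0"
    "real n + 1 \<noteq> 0" "real n + 2 \<noteq> 0"
  using neg by auto

lemma parameter_eqs: "b = real n - l - c - 1" "(l + b) / 2 = (real n - c - 1) / 2"
  using c by auto

text \<open>Over the common factor \<open>p k / (y + k)\<close> the coefficients add up to
  \<open>- (y + k)\<close>, which cancels the denominator. The right-hand side is free of
  \<open>x\<close>, so the sums agree term by term.\<close>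

lemma local_relation_up:
  "- (c * (c+1)) / ((real n + c + 1) * (real n + c)) * hahn_R (int n) x l (b - 2) (y + 1)
   + (y + (l+b)/2) * (- real n * c * (real n - 1 - l)) / (1/2 * (real n + c + 1) * (real n + c - 1)) * hahn_R (int n - 1) x l (b - 2) (y + 1)
   + (c - y) * (y + real n - 1) * (real n * (real n - 1) * (real n - 1 - l) * (real n - 2 - l)) / ((real n + c - 1) * (real n + c)) * hahn_R (int n - 2) x l (b - 2) (y + 1)
   = - hahn_R (int n) x l b y" (is "?A + ?B + ?C = _")
proof -
  define p where "p k = pochhammer (- real n) k * pochhammer c k * E k" for k
  have A: "?A = D * (\<Sum>k\<le>K. p k / (y + real k) * (- ((c + real k)*(c+real k+1)*(y+real n)) / ((real n+c+1)*(real n+c))))"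
  proof -
    have *: "c * (c+1) * pochhammer (c+2) k = (c + real k)*(c+real k+1) * pochhammer c k" for k
      using pochhammer_step[of c k] pochhammer_step[of "c+1" k] by (simp add: algebra_simps) algebra
    have "?A = D * (\<Sum>k\<le>K. pochhammer (- real n) k * (c * (c+1) * pochhammer (c+2) k) * (E k / (y + real k)) *
       (- ((y + real n) / ((real n+c+1)*(real n+c)))))"
      unfolding hahn_R_up_plus by (simp add: sum_distrib_left sum_distrib_right sum_divide_distrib mult_ac)
    then show ?thesis unfolding * p_def by (simp add: mult_ac)
  qed
  have B: "?B = D * (\<Sum>k\<le>K. p k / (y + real k) * (- ((y+(real n-c-1)/2)*(real n-real k)*(c+real k)) / (1/2*(real n+c+1)*(real n+c-1))))"
  proof -
    define w0 where "w0 = 1/2 * (real n + c + 1) * (real n + c - 1)"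
    have *: "c * pochhammer (c+1) k = (c + real k) * pochhammer c k" for k
      by (rule pochhammer_step)
    have "?B = (y + (l+b)/2) * (-c) / (1/2 * (real n + c + 1) * (real n + c - 1)) * (real n * (real n - 1 - l) * hahn_R (int n - 1) x l (b - 2) (y + 1))"
      by (simp add: mult_ac)
    also have "\<dots> = D * (\<Sum>k\<le>K. (real n - real k) * pochhammer (- real n) k * (c * pochhammer (c+1) k) * (E k / (y + real k)) *
       (- ((y+(real n-c-1)/2) / (1/2*(real n+c+1)*(real n+c-1)))))"
      unfolding hahn_R_up_0 parameter_eqs(2) w0_def[symmetric] by (simp add: sum_negf sum_distrib_left sum_distrib_right sum_divide_distrib mult_ac)
    finally show ?thesis unfolding * p_def w0_def[symmetric] by (simp add: mult_ac)
  qed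
  have C: "?C = D * (\<Sum>k\<le>K. p k / (y + real k) * ((c-y)*(real n-real k)*(real n-1-real k)/((real n+c-1)*(real n+c))))"
  proof -
    have "?C = (c - y) / ((real n + c - 1) * (real n + c)) * (real n * (real n - 1) * (real n - 1 - l) * (real n - 2 - l) * (y + real n - 1) * hahn_R (int n - 2) x l (b - 2) (y + 1))"
      by (simp add: mult_ac)
    also have "\<dots> = D * (\<Sum>k\<le>K. (real n - real k) * (real n - 1 - real k) * pochhammer (- real n) k * pochhammer c k * (E k / (y + real k)) *
       ((c-y) / ((real n+c-1)*(real n+c))))"
      unfolding hahn_R_up_minus by (simp add: sum_distrib_left sum_distrib_right sum_divide_distrib mult_ac)
    finally show ?thesis unfolding p_def by (simp add: mult_ac)
  qed
  have "?A + ?B + ?C = D * (\<Sum>k\<le>K. p k / (y + real k) *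
     (- ((c + real k)*(c+real k+1)*(y+real n)) / ((real n+c+1)*(real n+c))
      - (y+(real n-c-1)/2)*(real n-real k)*(c+real k) / (1/2*(real n+c+1)*(real n+c-1))
      + (c-y)*(real n-real k)*(real n-1-real k)/((real n+c-1)*(real n+c))))"
    unfolding A B C distrib_left[symmetric] sum.distrib[symmetric] by simp
  also have "\<dots> = D * (\<Sum>k\<le>K. - p k)"
    unfolding coeff_identity_up[OF neg_nonzero(1-3)] using nonint_add_nonzero(1)
    by (intro arg_cong[where f = "\<lambda>u. D * u"] sum.cong) (auto simp: field_simps)
  also have "\<dots> = - hahn_R (int n) x l b y"
    unfolding hahn_R_same p_def by (simp add: sum_negf)
  finally show ?thesis .
qed

lemma local_relation_same:
  "c / ((real n + c + 1) * (real n + c)) * hahn_R (int n + 1) x l b y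
   + (y + (l+b)/2) * (real n * c + b * (l+b+2)/2) / (1/2 * (real n + c + 1) * (real n + c - 1)) * hahn_R (int n) x l b y
   - (c - y) * (y + real n - 1) * (real n * (c + l) * (real n - 1 - l)) / ((real n + c - 1) * (real n + c)) * hahn_R (int n - 1) x l b y
   = (y + x + b/2) * hahn_R (int n) x l b y" (is "?A + ?B - ?C = _")
proof -
  \<comment> \<open>The lowest bases that occur: \<open>- n - 1\<close> comes from
    \<open>s = 1\<close> and \<open>c - 1\<close> from \<open>s = -1\<close>.\<close>
  define h where "h k = pochhammer (- real n - 1) k * pochhammer (c - 1) k * E k" for k
  define m where "m k = pochhammer (- real n) k * pochhammer c k * E k" for k
  \<comment> \<open>\<open>x (-x)\<^sub>k = k (-x)\<^sub>k - (-x)\<^sub>k\<^sub>+\<^sub>1\<close>, so multiplication by \<open>x\<close> contributes the shifted terms \<open>u\<close>,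
    and the difference of the two sides telescopes\<close>
  define u where "u k = (case k of 0 \<Rightarrow> 0 | Suc j \<Rightarrow> (real j - x) * m j)" for k
  have pn: "pochhammer (- real n) k = pochhammer (- real n - 1) k * ((real n + 1 - real k) / (real n + 1))" for k
    by (rule pochhammer_shift_neg) auto
  have pc: "pochhammer c k = pochhammer (c - 1) k * ((c - 1 + real k) / (c - 1))" for k
    by (rule pochhammer_shift) (use neg_nonzero in auto)
  have m: "m k = h k * ((real n + 1 - real k) * (c - 1 + real k) / ((real n + 1) * (c - 1)))" for k
    unfolding m_def h_def pn[of k] pc[of k] by simp
  have u: "u k = - (h k * (real k * (real k - 1 - l) * (y + real k - 1) / ((real n + 1) * (c - 1))))" for k
  proof (cases k)
    case (Suc j)
    have "pochhammer (- real n - 1) k = - (real n + 1) * pochhammer (- real n) j"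
      "pochhammer (c - 1) k = (c - 1) * pochhammer c j"
      unfolding Suc pochhammer_rec by simp_all
    then have "h k * (real k * (real k - 1 - l) * (y + real k - 1)) = - (real n + 1) * (c - 1) * pochhammer (- real n) j * pochhammer c j * (E (Suc j) * (real j + 1) * (real j - l) * (y + real j))"
      unfolding h_def using Suc by simp
    also have "\<dots> = (real n + 1) * (c - 1) * (- u k)"
      unfolding weight_Suc u_def m_def using Suc by (simp add: algebra_simps)
    finally have "- u k = h k * (real k * (real k - 1 - l) * (y + real k - 1) / ((real n + 1) * (c - 1)))"
      by (rule eq_mult_divideI[rotated]) (use neg_nonzero in simp)
    then show ?thesis by simp
  qed (simp add: u_def)
  have A: "?A = D * (\<Sum>k\<le>K. h k * ((y + real n)*(real n - l)*(c+real k)*((c-1+real k)/(c-1)) / ((real n+c+1)*(real n+c))))"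
  proof -
    have *: "c * pochhammer (c+1) k = pochhammer (c-1) k * ((c + real k)*((c-1+real k)/(c-1)))" for k
      using pochhammer_step[of c k] unfolding pc by simp
    have "?A = D * (\<Sum>k\<le>K. pochhammer (- real n - 1) k * (c * pochhammer (c+1) k) * E k *
       ((y + real n) * (real n - l) / ((real n+c+1)*(real n+c))))"
      unfolding hahn_R_same_plus by (simp add: sum_distrib_left sum_distrib_right sum_divide_distrib mult_ac)
    then show ?thesis unfolding * h_def by (simp add: mult_ac)
  qed
  have B: "?B = D * (\<Sum>k\<le>K. h k * ((y+(real n-c-1)/2)*(real n*c+(real n-l-c-1)*(real n-c+1)/2) *((real n+1-real k)*(c-1+real k)/((real n+1)*(c-1)))/ (1/2*(real n+c+1)*(real n+c-1))))"
  proof -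
    have "b * (l + b + 2) = (real n-l-c-1)*(real n-c+1)" using parameter_eqs(1) by simp
    then have "?B = D * (\<Sum>k\<le>K. m k * ((y+(real n-c-1)/2)*(real n*c+(real n-l-c-1)*(real n-c+1)/2) / (1/2*(real n+c+1)*(real n+c-1))))"
      unfolding hahn_R_same parameter_eqs(2) m_def by (simp add: sum_distrib_left sum_distrib_right sum_divide_distrib mult_ac)
    then show ?thesis unfolding m by (simp add: mult_ac)
  qed
  have C: "?C = D * (\<Sum>k\<le>K. h k * ((c-y)*(c+l)*((real n-real k)*(real n+1-real k)/(real n+1))/((real n+c-1)*(real n+c))))"
  proof -
    have "?C = (c - y) * (c + l) / ((real n + c - 1) * (real n + c)) * (real n * (real n - 1 - l) * (y + real n - 1) * hahn_R (int n - 1) x l b y)"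
      by (simp add: mult_ac)
    also have "\<dots> = D * (\<Sum>k\<le>K. (real n - real k) * pochhammer (- real n) k * pochhammer (c-1) k * E k *
       ((c-y) * (c+l) / ((real n+c-1)*(real n+c))))"
      unfolding hahn_R_same_minus by (simp add: sum_distrib_left sum_distrib_right sum_divide_distrib mult_ac)
    finally show ?thesis unfolding pn h_def by (simp add: mult_ac)
  qed
  have "?A + ?B - ?C = D * (\<Sum>k\<le>K. h k *
     ((y+(real n-l-c-1)/2+real k)*((real n+1-real k)*(c-1+real k)/((real n+1)*(c-1))) + real k*(real k-1-l)*(y+real k-1)/((real n+1)*(c-1))))"
    unfolding A B C distrib_left[symmetric] right_diff_distrib[symmetric] sum.distrib[symmetric] sum_subtractf[symmetric]
      coeff_identity_0[OF neg_nonzero(1-3,7,5)] ..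
  also have "\<dots> = D * (\<Sum>k\<le>K. (y + x + b/2) * m k + (u (Suc k) - u k))"
  proof (intro arg_cong[where f = "\<lambda>u. D * u"] sum.cong refl)
    fix k
    let ?m = "(real n+1-real k)*(c-1+real k)/((real n+1)*(c-1))"
    let ?u = "real k*(real k-1-l)*(y+real k-1)/((real n+1)*(c-1))"
    have "h k * ((y+(real n-l-c-1)/2+real k) * ?m + ?u) = (y + b/2 + real k) * (h k * ?m) + h k * ?u"
      unfolding parameter_eqs(1) by (simp only: distrib_left mult.left_commute)
    also have "\<dots> = (y + x + b/2) * m k + (u (Suc k) - u k)"
      unfolding m[symmetric] u[of k] by (simp add: u_def algebra_simps)
    finally show "h k * ((y+(real n-l-c-1)/2+real k) * ?m + ?u) = (y + x + b/2) * m k + (u (Suc k) - u k)" .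
  qed
  also have "\<dots> = D * ((y + x + b/2) * (\<Sum>k\<le>K. m k) + (u (Suc K) - u 0))"
    by (simp add: sum.distrib sum_distrib_left sum_lessThan_telescope lessThan_Suc_atMost[symmetric] del: sum.lessThan_Suc)
  \<comment> \<open>The upper boundary term contains \<open>(-n)_K\<close>, which is zero because
    \<open>K > n\<close>.\<close>
  also have "u (Suc K) - u 0 = 0"
    using K by (simp add: u_def m_def pochhammer_minus_nat_eq_0)
  finally show ?thesis unfolding hahn_R_same m_def by simp
qed

lemma local_relation_down:
  "- 1 / ((real n + c + 1) * (real n + c)) * hahn_R (int n + 2) x l (b + 2) (y - 1)
   - (y + (l+b)/2) * (c + l) / (1/2 * (real n + c + 1) * (real n + c - 1)) * hahn_R (int n + 1) x l (b + 2) (y - 1)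
   + (c - y) * (y + real n - 1) * ((c + l) * (c + l - 1)) / ((real n + c - 1) * (real n + c)) * hahn_R (int n) x l (b + 2) (y - 1)
   = (- b - y - x - 1) * (y + x - 1) * hahn_R (int n) x l b y" (is "?A - ?B + ?C = _")
proof -
  define h where "h k = pochhammer (- real n - 2) k * pochhammer (c - 2) k * E k" for k
  define m where "m k = pochhammer (- real n) k * pochhammer c k * E k" for k
  \<comment> \<open>here the right-hand side is quadratic in \<open>x\<close>: \<open>a\<close> collects the terms shifted once,
    \<open>d\<close> those shifted twice\<close>
  define a where "a k = (case k of 0 \<Rightarrow> 0 | Suc j \<Rightarrow> (real j - x) * m j)" for k
  define d where "d k = (case k of 0 \<Rightarrow> 0 | Suc j \<Rightarrow> (real j - x) * a j)" for k
  \<comment> \<open>Writing \<open>x = k - (k-x)\<close> and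
    \<open>(k-x)^2 = (k-x)(k+1-x) - (k-x)\<close> expresses the quadratic factor times
    \<open>m k\<close> through \<open>m k\<close>, \<open>a (k+1)\<close> and
    \<open>d (k+2)\<close>. Lowering the index of the \<open>a\<close>-part by one and of the
    \<open>d\<close>-part by two gives \<open>V k\<close>; the differences of \<open>W\<close>
    account for this lowering.\<close>
  define V where "V k = a k * (b + 2 * y + 2 * real k - 1) - d k" for k
  define W where "W k = V k - d (Suc k)" for k
  let ?den = "(real n+2)*(real n+1)*(c-2)*(c-1)"
  have pn1: "pochhammer (- real n - 1) k = pochhammer (- real n - 2) k * ((real n + 2 - real k) / (real n + 2))" for k
    by (rule pochhammer_shift_neg) auto
  have pn: "pochhammer (- real n) k = pochhammer (- real n - 2) k * ((real n + 2 - real k) * (real n + 1 - real k) / ((real n + 2) * (real n + 1)))" for k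
  proof -
    have "pochhammer (- real n) k = pochhammer (- real n - 1) k * ((real n + 1 - real k) / (real n + 1))"
      by (rule pochhammer_shift_neg) auto
    then show ?thesis unfolding pn1 by (simp only: times_divide_times_eq mult.assoc)
  qed
  have pc1: "pochhammer (c - 1) k = pochhammer (c - 2) k * ((c - 2 + real k) / (c - 2))" for k
    by (rule pochhammer_shift) (use neg_nonzero in auto)
  have pc: "pochhammer c k = pochhammer (c - 2) k * ((c - 2 + real k) * (c - 1 + real k) / ((c - 2) * (c - 1)))" for k
  proof -
    have "pochhammer c k = pochhammer (c - 1) k * ((c - 1 + real k) / (c - 1))"
      by (rule pochhammer_shift) (use neg_nonzero in auto)
    then show ?thesis unfolding pc1 by (simp only: times_divide_times_eq mult.assoc)
  qed
  have m: "m k = h k * ((real n + 2 - real k) * (real n + 1 - real k) * (c - 2 + real k) * (c - 1 + real k) / ?den)" for k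
    unfolding m_def h_def pn[of k] pc[of k] by (simp add: mult_ac)
  have a: "a k = - (h k * (real k * (real k - 1 - l) * (y + real k - 1) * (real n + 2 - real k) * (c - 2 + real k) / ?den))" for k
  proof (cases k)
    case (Suc j)
    have 1: "pochhammer (- real n - 2) k * (real n + 2 - real k) = - (real n + 2) * (real n + 1) * pochhammer (- real n) j"
    proof -
      have "pochhammer (- real n - 2) k * (real n + 2 - real k) = (real n + 2) * pochhammer (- real n - 1) k"
        unfolding pn1[of k] by simp
      moreover have "pochhammer (- real n - 1) k = (- real n - 1) * pochhammer (- real n) j"
        unfolding Suc pochhammer_rec by simp
      ultimately show ?thesis by algebra
    qed
    have 2: "pochhammer (c - 2) k * (c - 2 + real k) = (c - 2) * (c - 1) * pochhammer c j"
    proof -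
      have "pochhammer (c - 2) k * (c - 2 + real k) = (c - 2) * pochhammer (c - 1) k"
        unfolding pc1[of k] using neg_nonzero by simp
      moreover have "pochhammer (c - 1) k = (c - 1) * pochhammer c j"
        unfolding Suc pochhammer_rec by simp
      ultimately show ?thesis by algebra
    qed
    have "h k * (real k * (real k - 1 - l) * (y + real k - 1) * (real n + 2 - real k) * (c - 2 + real k)) =
      (pochhammer (- real n - 2) k * (real n + 2 - real k)) * (pochhammer (c - 2) k * (c - 2 + real k)) * (E (Suc j) * (real j + 1) * (real j - l) * (y + real j))"
      unfolding h_def using Suc by simp
    also have "\<dots> = ?den * (- a k)"
      unfolding weight_Suc a_def m_def 1 2 using Suc by (simp add: algebra_simps)
    finally have "- a k = h k * (real k * (real k - 1 - l) * (y + real k - 1) * (real n + 2 - real k) * (c - 2 + real k) / ?den)"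
      by (rule eq_mult_divideI[rotated]) (use neg_nonzero in simp)
    then show ?thesis by simp
  qed (simp add: a_def)
  have d: "d k = h k * (real k * (real k - 1) * (real k - 1 - l) * (real k - 2 - l) * (y + real k - 1) * (y + real k - 2) / ?den)" for k
  proof (cases k)
    case (Suc j)
    have 1: "pochhammer (- real n - 2) k = (- real n - 2 + real j) * pochhammer (- real n - 2) j"
      "pochhammer (c - 2) k = (c - 2 + real j) * pochhammer (c - 2) j"
      unfolding Suc by (rule pochhammer_rec')+
    have "h k * (real k * (real k - 1) * (real k - 1 - l) * (real k - 2 - l) * (y + real k - 1) * (y + real k - 2)) =
      (- real n - 2 + real j) * (c - 2 + real j) * pochhammer (- real n - 2) j * pochhammer (c - 2) j *
       (E (Suc j) * (real j + 1) * (real j - l) * (y + real j)) * (real j * (real j - 1 - l) * (y + real j - 1))"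
      unfolding h_def 1 using Suc by simp
    also have "\<dots> = ?den * d k"
    proof -
      \<comment> \<open>\<open>d k = (j-x) * a j\<close>, so the formula for \<open>a\<close> is
        reused at \<open>j\<close>, and \<open>weight_Suc\<close> turns \<open>(j-x) * E j\<close>
        into a multiple of \<open>E k\<close>.\<close>
      have 2: "?den * a j = - (h j * (real j * (real j - 1 - l) * (y + real j - 1) * (real n + 2 - real j) * (c - 2 + real j)))"
        unfolding a using neg_nonzero by simp
      have "?den * d k = (real j - x) * (?den * a j)"
        unfolding d_def using Suc by simp
      then show ?thesis
        unfolding weight_Suc 2 h_def by algebra
    qed
    finally show ?thesis
      by (rule eq_mult_divideI[rotated]) (use neg_nonzero in simp)
  qed (simp add: d_def)
  have A: "?A = D * (\<Sum>k\<le>K. h k * (y - 1 + real k) * (- ((y+real n)*(real n-l)*(real n+1-l)*((c-2+real k)*(c-1+real k)/((c-2)*(c-1)))) / ((real n+c+1)*(real n+c))))"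
  proof -
    have "?A = D * (\<Sum>k\<le>K. pochhammer (- real n - 2) k * pochhammer c k * ((y - 1 + real k) * E k) *
       (- ((y + real n) * (real n - l) * (real n + 1 - l)) / ((real n+c+1)*(real n+c))))"
      unfolding hahn_R_down_plus by (simp add: sum_distrib_left sum_distrib_right sum_divide_distrib sum_negf mult_ac)
    then show ?thesis unfolding pc h_def by (simp add: mult_ac)
  qed
  have B: "?B = D * (\<Sum>k\<le>K. h k * (y - 1 + real k) * ((y+(real n-c-1)/2)*(c+l)*(real n-l)*((real n+2-real k)*(c-2+real k)/((real n+2)*(c-2)))/ (1/2*(real n+c+1)*(real n+c-1))))"
  proof -
    define w0 where "w0 = 1/2 * (real n + c + 1) * (real n + c - 1)"
    have "?B = D * (\<Sum>k\<le>K. pochhammer (- real n - 1) k * pochhammer (c - 1) k * ((y - 1 + real k) * E k) * ((y+(real n-c-1)/2)*(c+l)*(real n-l)/ (1/2*(real n+c+1)*(real n+c-1))))"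
      unfolding hahn_R_down_0 parameter_eqs(2) w0_def[symmetric] by (simp add: sum_distrib_left sum_distrib_right sum_divide_distrib mult_ac)
    then show ?thesis unfolding pn1 pc1 h_def w0_def[symmetric] by (simp add: mult_ac)
  qed
  have C: "?C = D * (\<Sum>k\<le>K. h k * (y - 1 + real k) * ((c-y)*(c+l)*(c+l-1)*((real n+2-real k)*(real n+1-real k)/((real n+2)*(real n+1)))/((real n+c-1)*(real n+c))))"
  proof -
    have "?C = (c - y) * (c + l) * (c + l - 1) / ((real n + c - 1) * (real n + c)) * ((y + real n - 1) * hahn_R (int n) x l (b + 2) (y - 1))"
      by (simp add: mult_ac)
    also have "\<dots> = D * (\<Sum>k\<le>K. pochhammer (- real n) k * pochhammer (c-2) k * ((y - 1 + real k) * E k) *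
       ((c-y) * (c+l) * (c + l - 1) / ((real n+c-1)*(real n+c))))"
      unfolding hahn_R_down_minus by (simp add: sum_distrib_left sum_distrib_right sum_divide_distrib mult_ac)
    finally show ?thesis unfolding pn h_def by (simp add: mult_ac)
  qed
  have "?A - ?B + ?C = D * (\<Sum>k\<le>K. h k * (y - 1 + real k) * (
   (- (real k+real n-l-c+y)*((real n+2-real k)*(real n+1-real k)*(c-2+real k)*(c-1+real k))
    - (real n-l-c-1+2*y+2*real k-1)*real k*(real k-1-l)*(real n+2-real k)*(c-2+real k)
    - real k*(real k-1)*(real k-1-l)*(real k-2-l)*(y+real k-2)) / ?den))"
    unfolding A B C distrib_left[symmetric] right_diff_distrib[symmetric] sum.distrib[symmetric] sum_subtractf[symmetric]
      coeff_identity_down[OF neg_nonzero(1-3,7,5,8,6)] ..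
  also have "\<dots> = D * (\<Sum>k\<le>K. - (real k + b + y + 1) * (y - 1 + real k) * m k + V k)"
  proof (intro arg_cong[where f = "\<lambda>u. D * u"] sum.cong refl)
    fix k
    \<comment> \<open>The common denominator enters linearly through \<open>i\<close>; what remains
      is a polynomial identity.\<close>
    define i where "i = 1 / ?den"
    have "m k = h k * ((real n + 2 - real k) * (real n + 1 - real k) * (c - 2 + real k) * (c - 1 + real k)) * i"
      "a k = - (h k * (real k * (real k - 1 - l) * (y + real k - 1) * (real n + 2 - real k) * (c - 2 + real k)) * i)"
      "d k = h k * (real k * (real k - 1) * (real k - 1 - l) * (real k - 2 - l) * (y + real k - 1) * (y + real k - 2)) * i"
      unfolding m a d i_def by simp_all
    then have "h k * (y - 1 + real k) * (
     (- (real k+real n-l-c+y)*((real n+2-real k)*(real n+1-real k)*(c-2+real k)*(c-1+real k))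
      - (real n-l-c-1+2*y+2*real k-1)*real k*(real k-1-l)*(real n+2-real k)*(c-2+real k)
      - real k*(real k-1)*(real k-1-l)*(real k-2-l)*(y+real k-2)) * i) =
      - (real k + b + y + 1) * (y - 1 + real k) * m k + V k"
      unfolding V_def parameter_eqs(1) by algebra
    then show "h k * (y - 1 + real k) * (
     (- (real k+real n-l-c+y)*((real n+2-real k)*(real n+1-real k)*(c-2+real k)*(c-1+real k))
      - (real n-l-c-1+2*y+2*real k-1)*real k*(real k-1-l)*(real n+2-real k)*(c-2+real k)
      - real k*(real k-1)*(real k-1-l)*(real k-2-l)*(y+real k-2)) / ?den) =
      - (real k + b + y + 1) * (y - 1 + real k) * m k + V k"
      unfolding i_def by simp
  qed
  also have "\<dots> = D * (\<Sum>k\<le>K. (- b - y - x - 1) * (y + x - 1) * m k - (W (Suc k) - W k))"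
  proof (intro arg_cong[where f = "\<lambda>u. D * u"] sum.cong refl)
    fix k
    have "a (Suc k) = (real k - x) * m k" "d (Suc (Suc k)) = (real (Suc k) - x) * a (Suc k)"
      by (simp_all add: a_def d_def)
    then show "- (real k + b + y + 1) * (y - 1 + real k) * m k + V k =
        (- b - y - x - 1) * (y + x - 1) * m k - (W (Suc k) - W k)"
      unfolding W_def V_def of_nat_Suc by algebra
  qed
  also have "\<dots> = D * ((- b - y - x - 1) * (y + x - 1) * (\<Sum>k\<le>K. m k) - (W (Suc K) - W 0))"
  proof -
    have "(\<Sum>k\<le>K. W (Suc k) - W k) = W (Suc K) - W 0"
      using sum_lessThan_telescope[of W "Suc K"] by (simp only: lessThan_Suc_atMost)
    then show ?thesis by (simp add: sum_subtractf sum_distrib_left)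
  qed
  \<comment> \<open>\<open>W (Suc K)\<close> reaches down to \<open>m (K - 1)\<close>, which
    vanishes since \<open>K \<ge> n + 2\<close>.\<close>
  also have "W (Suc K) - W 0 = 0"
    using K by (simp add: W_def V_def a_def d_def m_def pochhammer_minus_nat_eq_0 split: nat.split)
  finally show ?thesis unfolding hahn_R_same m_def by simp
qed
end

section \<open>From generic to arbitrary parameters by continuity\<close>

lemma tendsto_pochhammer:
  fixes f :: "'a \<Rightarrow> real"
  shows "(f \<longlongrightarrow> a) F \<Longrightarrow> ((\<lambda>e. pochhammer (f e) k) \<longlongrightarrow> pochhammer a k) F"
  by (induction k) (auto simp: pochhammer_Suc intro!: tendsto_intros)

lemma tendsto_hahn_R:
  assumes "(l \<longlongrightarrow> l0) F" "(b \<longlongrightarrow> b0) F" "(y \<longlongrightarrow> y0) F"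
  shows "((\<lambda>e. hahn_R v x (l e) (b e) (y e)) \<longlongrightarrow> hahn_R v x l0 b0 y0) F"
  unfolding hahn_R_def using assms
  by (cases "v < 0") (auto intro!: tendsto_intros tendsto_pochhammer)

lemma eventually_nonint: "eventually (\<lambda>e. a + e \<notin> \<int>) (at_right (0 :: real))"
proof -
  \<comment> \<open>The distance from \<open>a\<close> to the next larger integer.\<close>
  define r where "r = real_of_int (floor a) + 1 - a"
  have "0 < r" unfolding r_def by linarith
  moreover have "a + e \<notin> \<int>" if "e \<in> {0<..<r}" for e
  proof
    assume "a + e \<in> \<int>"
    then obtain z where "a + e = of_int z" by (auto elim: Ints_cases)
    then have "floor a < z" "z < floor a + 1" using that unfolding r_def by (auto simp: floor_less_iff)
    then show False by simp
  qed
  ultimately show ?thesis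
    using eventually_at_right_real[of 0 r] by (auto elim: eventually_mono)
qed

lemma tendsto_if_const:
  "(P \<Longrightarrow> (f \<longlongrightarrow> a) F) \<Longrightarrow> (\<not> P \<Longrightarrow> (g \<longlongrightarrow> b) F) \<Longrightarrow>
    ((\<lambda>e. if P then f e else g e) \<longlongrightarrow> (if P then a else b)) F"
  by simp

text \<open>The values \<open>B\<^sub>0\<^sup>0\<^sup>s\<close> times \<open>(-M)\<^sub>m / (-M)\<^sub>m\<^sub>+\<^sub>s\<close>, for \<open>M = N\<close>, \<open>L = |l|\<close> and \<open>m = |\<nu>|\<close>.\<close>

definition edge_coeff :: "real \<Rightarrow> real \<Rightarrow> real \<Rightarrow> int \<Rightarrow> real"
  where "edge_coeff M L m s =
    (if s = 0 then - M + L / 2 else if s = 1 then - 1 else (m - L + M - 1) * (m - M - 1))"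

text \<open>The values \<open>B\<^sub>i\<^sup>s\<^sup>t\<close> times \<open>(-l)\<^sub>v / (-l)\<^sub>v\<^sub>+\<^sub>s\<^sub>-\<^sub>t\<close>, which are again polynomial, for \<open>v = \<nu>\<^sub>i\<close>,
  \<open>l = l\<^sub>i\<close> and \<open>b = |l\<^sup>i\<^sup>+\<^sup>1| - 2 |\<nu>\<^sup>i\<^sup>+\<^sup>1|\<close>.\<close>

definition step_coeff :: "real \<Rightarrow> real \<Rightarrow> real \<Rightarrow> int \<Rightarrow> int \<Rightarrow> real"
  where "step_coeff v l b s t =
    (let c = v - l - b - 1 in
       if s = 0 \<and> t = 0 then v * c + b * (l + b + 2) / 2
       else if s = 0 \<and> t = 1 then - v * c * (v - 1 - l)
       else if s = 0 \<and> t = -1 then - (c + l)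
       else if s = 1 \<and> t = 0 then - c
       else if s = -1 \<and> t = 0 then - v * (c + l) * (v - 1 - l)
       else if s = 1 \<and> t = 1 then c * (c + 1)
       else if s = -1 \<and> t = 1 then v * (v - 1) * (v - 1 - l) * (v - 2 - l)
       else if s = 1 \<and> t = -1 then 1
       else (c + l) * (c + l - 1))"

text \<open>The coefficients \<open>b_i\<close> as functions of
  \<open>w = 2 |\<nu>^i| - |l^i|\<close> alone.\<close>

definition denom :: "real \<Rightarrow> int \<Rightarrow> real"
  where "denom w s = (if s = 0 then 1 / 2 * w * (w - 2) else if s = 1 then w * (w - 1) else (w - 2) * (w - 1))"

text \<open>One transfer step: the edge vector for \<open>(- y, l + b, n)\<close> is carried to the
  one for \<open>(- y - x, b, 0)\<close>. The values \<open>t = 0, 1, -1\<close> are the three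
  relations above.\<close>

lemma local_relation_generic:
  assumes y: "y \<notin> \<int>" and l: "l \<notin> \<int>" and neg: "2 * real n - l - b < 0" and t: "t \<in> {-1, 0, 1}"
  shows "(\<Sum>s\<in>{-1, 0, 1}. edge_coeff (- y) (l + b) (real n) s * step_coeff (real n) l b s t /
       denom (2 * real n - l - b) s * hahn_R (int n + s - t) x l (b - 2 * of_int t) (y + of_int t)) =
    hahn_R (int n) x l b y * edge_coeff (- y - x) b 0 t"
proof -
  define c where "c = real n - l - b - 1"
  have w: "2 * real n - l - b = real n + c + 1" and neg': "real n + c + 1 < 0"
    using neg by (simp_all add: c_def)
  have S: "(\<Sum>s\<in>{-1, 0, 1}. f s) = f 1 + f 0 + f (-1)" for f :: "int \<Rightarrow> real"
    by simp
  have d: "denom (real n + c + 1) 1 = (real n + c + 1) * (real n + c)"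
    "denom (real n + c + 1) 0 = 1/2 * (real n + c + 1) * (real n + c - 1)"
    "denom (real n + c + 1) (-1) = (real n + c - 1) * (real n + c)"
    unfolding denom_def by simp_all
  have e: "edge_coeff (- y) (l + b) (real n) 1 = - 1"
    "edge_coeff (- y) (l + b) (real n) 0 = y + (l + b) / 2"
    "edge_coeff (- y) (l + b) (real n) (-1) = (c - y) * (y + real n - 1)"
    unfolding edge_coeff_def c_def by (simp_all add: algebra_simps)
  consider "t = 0" | "t = 1" | "t = -1" using t by auto
  then show ?thesis
  proof cases
    case 1
    have sc: "step_coeff (real n) l b 1 0 = - c"
      "step_coeff (real n) l b 0 0 = real n * c + b * (l + b + 2) / 2"
      "step_coeff (real n) l b (-1) 0 = - (real n * (c + l) * (real n - 1 - l))"
      unfolding step_coeff_def c_def by (simp_all add: Let_def)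
    show ?thesis
      unfolding S 1 w d e sc
      using local_relation_same[OF y l c_def neg' order.refl refl refl, of x]
      by (simp add: edge_coeff_def mult.commute)
  next
    case 2
    have sc: "step_coeff (real n) l b 1 1 = c * (c + 1)"
      "step_coeff (real n) l b 0 1 = - real n * c * (real n - 1 - l)"
      "step_coeff (real n) l b (-1) 1 = real n * (real n - 1) * (real n - 1 - l) * (real n - 2 - l)"
      unfolding step_coeff_def c_def by (simp_all add: Let_def)
    show ?thesis
      unfolding S 2 w d e sc
      using local_relation_up[OF y l c_def neg' order.refl refl refl, of x]
      by (simp add: edge_coeff_def algebra_simps)
  next
    case 3
    have sc: "step_coeff (real n) l b 1 (-1) = 1"
      "step_coeff (real n) l b 0 (-1) = - (c + l)"
      "step_coeff (real n) l b (-1) (-1) = (c + l) * (c + l - 1)"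
      unfolding step_coeff_def c_def by (simp_all add: Let_def)
    have ex: "edge_coeff (- y - x) b 0 (-1) = (- b - y - x - 1) * (y + x - 1)"
      by (simp add: edge_coeff_def algebra_simps)
    define q where "q = c + l"
    have idx: "int n + 1 - (-1) = int n + 2" "int n + 0 - (-1) = int n + 1" "int n + (-1) - (-1) = int n"
      by simp_all
    show ?thesis
      unfolding S 3 w d e sc ex idx
      using local_relation_down[OF y l c_def neg' order.refl refl refl, of x]
      unfolding q_def[symmetric] by simp
  qed
qed

text \<open>Both sides are continuous along \<open>(l + e, b - e, y + e)\<close>. This path keeps
  \<open>l + b\<close>, hence the nonzero denominators, fixed, and for small \<open>e > 0\<close> it
  makes \<open>l\<close> and \<open>y\<close> non-integral.\<close>

lemma local_relation:
  assumes neg: "2 * real n - l - b < 0" and t: "t \<in> {-1, 0, 1}"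
  shows "(\<Sum>s\<in>{-1, 0, 1}. edge_coeff (- y) (l + b) (real n) s * step_coeff (real n) l b s t /
       denom (2 * real n - l - b) s * hahn_R (int n + s - t) x l (b - 2 * of_int t) (y + of_int t)) =
    hahn_R (int n) x l b y * edge_coeff (- y - x) b 0 t" (is "?L l b y = ?R l b y")
proof -
  have sc: "((\<lambda>e. step_coeff (real n) (l + e) (b - e) s t) \<longlongrightarrow> step_coeff (real n) (l + 0) (b - 0) s t) (at_right 0)" for s
    unfolding step_coeff_def Let_def by (intro tendsto_if_const tendsto_intros) auto
  have ec: "((\<lambda>e. edge_coeff (f e) (g e) m s) \<longlongrightarrow> edge_coeff (f 0) (g 0) m s) (at_right 0)"
    if "(f \<longlongrightarrow> f 0) (at_right 0)" "(g \<longlongrightarrow> g 0) (at_right 0)" for f g :: "real \<Rightarrow> real" and m s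
    unfolding edge_coeff_def using that
    by (cases "s = 0"; cases "s = 1") (auto intro!: tendsto_intros)
  have dn: "2 * real n - (l + e) - (b - e) = 2 * real n - l - b" for e by simp
  have dnz: "denom (2 * real n - l - b) s \<noteq> 0" for s
    using neg by (auto simp: denom_def)
  have L: "((\<lambda>e. ?L (l + e) (b - e) (y + e)) \<longlongrightarrow> ?L (l + 0) (b - 0) (y + 0)) (at_right 0)"
    unfolding dn by (intro tendsto_sum tendsto_mult tendsto_divide tendsto_const dnz sc ec tendsto_hahn_R)
      (auto intro!: tendsto_eq_intros)
  have R: "((\<lambda>e. ?R (l + e) (b - e) (y + e)) \<longlongrightarrow> ?R (l + 0) (b - 0) (y + 0)) (at_right 0)"
    by (intro tendsto_mult tendsto_const ec tendsto_hahn_R) (auto intro!: tendsto_eq_intros)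
  have "eventually (\<lambda>e. ?L (l + e) (b - e) (y + e) = ?R (l + e) (b - e) (y + e)) (at_right 0)"
    using eventually_nonint[of y] eventually_nonint[of l]
  proof eventually_elim
    case (elim e)
    show ?case by (rule local_relation_generic) (use elim neg t in auto)
  qed
  from tendsto_cong[OF this] L
  have "((\<lambda>e. ?R (l + e) (b - e) (y + e)) \<longlongrightarrow> ?L (l + 0) (b - 0) (y + 0)) (at_right 0)" by simp
  from tendsto_unique[OF _ this R] show ?thesis by simp
qed

subsection \<open>Summation over the shifts\<close>

lemma tail_sum_rec: "i \<le> m \<Longrightarrow> tail_sum m v i = v i + tail_sum m v (i + 1)"
  unfolding tail_sum_def by (simp add: sum.atLeast_Suc_atMost)

lemma tail_sum_beyond: "m < i \<Longrightarrow> tail_sum m v i = 0"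
  unfolding tail_sum_def by simp

lemma tail_sum_nonneg: "nonneg_index d \<nu> \<Longrightarrow> 1 \<le> i \<Longrightarrow> 0 \<le> tail_sum d \<nu> i"
  unfolding tail_sum_def nonneg_index_def by (intro sum_nonneg) auto

text \<open>The increments \<open>\<mu>_j - \<mu>_(j+1)\<close> telescope, and
  \<open>\<mu>_(d+1) = 0\<close>.\<close>

lemma tail_sum_shift:
  assumes "\<mu> \<in> signs d" "1 \<le> i" "i \<le> d + 1"
  shows "tail_sum d (shift d \<mu> \<nu>) i = tail_sum d \<nu> i + \<mu> i"
  using assms(3,2)
proof (induction i rule: inc_induct)
  case base
  then show ?case using assms(1) by (simp add: tail_sum_beyond signs_def)
next
  case (step i)
  then show ?case
    by (simp add: tail_sum_rec[of i] shift_def)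
qed

lemma signs_0: "signs 0 = {\<lambda>_. 0}"
  by (auto simp: signs_def)

lemma signs_Suc:
  "bij_betw (\<lambda>(s, \<mu>). \<mu>(Suc d := s)) ({-1, 0, 1} \<times> signs d) (signs (Suc d))"
proof (rule bij_betw_byWitness[where f' = "\<lambda>\<mu>. (\<mu> (Suc d), \<mu>(Suc d := 0))"])
  show "\<forall>a\<in>{-1, 0, 1} \<times> signs d.
      (\<lambda>\<mu>. (\<mu> (Suc d), \<mu>(Suc d := 0))) (case a of (s, \<mu>) \<Rightarrow> \<mu>(Suc d := s)) = a"
    by (auto simp: signs_def fun_eq_iff)
  show "\<forall>a'\<in>signs (Suc d). (case (a' (Suc d), a'(Suc d := 0)) of (s, \<mu>) \<Rightarrow> \<mu>(Suc d := s)) = a'"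
    by auto
  show "(\<lambda>(s, \<mu>). \<mu>(Suc d := s)) ` ({-1, 0, 1} \<times> signs d) \<subseteq> signs (Suc d)"
    by (force simp: signs_def le_Suc_eq)
  show "(\<lambda>\<mu>. (\<mu> (Suc d), \<mu>(Suc d := 0))) ` signs (Suc d) \<subseteq> {-1, 0, 1} \<times> signs d"
    by (auto simp: signs_def le_Suc_eq)
qed

text \<open>A row vector times a product of matrices, where each matrix maps \<open>g i\<close> to a
  multiple of \<open>g (i + 1)\<close>. The right boundary value \<open>t\<close> is arbitrary, as
  the induction requires; it is written into position \<open>d + 1\<close>, where members of
  \<open>signs d\<close> are zero.\<close>

lemma sum_signs_transfer:
  fixes g :: "nat \<Rightarrow> int \<Rightarrow> real" and A :: "nat \<Rightarrow> int \<Rightarrow> int \<Rightarrow> real"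
  assumes "\<And>i t. i \<in> {1..d} \<Longrightarrow> t \<in> {-1, 0, 1} \<Longrightarrow> (\<Sum>s\<in>{-1, 0, 1}. g i s * A i s t) = r i * g (i + 1) t"
    and "t \<in> {-1, 0, 1}"
  shows "(\<Sum>\<mu>\<in>signs d. g 1 ((\<mu>(d + 1 := t)) 1) * (\<Prod>i\<in>{1..d}. A i (\<mu> i) ((\<mu>(d + 1 := t)) (i + 1)))) =
    (\<Prod>i\<in>{1..d}. r i) * g (d + 1) t"
  using assms
proof (induction d arbitrary: t)
  case 0
  then show ?case by (simp add: signs_0)
next
  case (Suc d)
  let ?F = "\<lambda>d t \<mu>. g 1 ((\<mu>(d + 1 := t)) 1) * (\<Prod>i\<in>{1..d}. A i (\<mu> i) ((\<mu>(d + 1 := t)) (i + 1)))"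
  \<comment> \<open>The last entry \<open>s\<close> becomes the right boundary value of the shorter
    product.\<close>
  have F: "?F (Suc d) t (\<mu>(Suc d := s)) = ?F d s \<mu> * A (Suc d) s t" for s \<mu>
  proof -
    have "(\<Prod>i\<in>{1..d}. A i ((\<mu>(Suc d := s)) i) (((\<mu>(Suc d := s))(Suc d + 1 := t)) (i + 1))) =
        (\<Prod>i\<in>{1..d}. A i (\<mu> i) ((\<mu>(d + 1 := s)) (i + 1)))"
      by (intro prod.cong) auto
    then show ?thesis by (simp add: mult_ac)
  qed
  have "(\<Sum>\<mu>\<in>signs (Suc d). ?F (Suc d) t \<mu>) = (\<Sum>(s, \<mu>)\<in>{-1, 0, 1} \<times> signs d. ?F (Suc d) t (\<mu>(Suc d := s)))"
    by (subst sum.reindex_bij_betw[OF signs_Suc, symmetric]) (simp add: case_prod_unfold)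
  also have "\<dots> = (\<Sum>s\<in>{-1, 0, 1}. (\<Sum>\<mu>\<in>signs d. ?F d s \<mu>) * A (Suc d) s t)"
    unfolding F sum.cartesian_product[symmetric] sum_distrib_right ..
  also have "\<dots> = (\<Sum>s\<in>{-1, 0, 1}. ((\<Prod>i\<in>{1..d}. r i) * g (Suc d) s) * A (Suc d) s t)"
  proof (intro sum.cong refl)
    fix s :: int assume "s \<in> {-1, 0, 1}"
    with Suc.IH[of s] Suc.prems(1)
    show "(\<Sum>\<mu>\<in>signs d. ?F d s \<mu>) * A (Suc d) s t = ((\<Prod>i\<in>{1..d}. r i) * g (Suc d) s) * A (Suc d) s t"
      by simp
  qed
  also have "\<dots> = (\<Prod>i\<in>{1..d}. r i) * (\<Sum>s\<in>{-1, 0, 1}. g (Suc d) s * A (Suc d) s t)"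
    by (simp only: sum_distrib_left mult.assoc)
  also have "\<dots> = (\<Prod>i\<in>{1..Suc d}. r i) * g (Suc d + 1) t"
    using Suc.prems(1)[of "Suc d" t] Suc.prems(2) by simp
  finally show ?case .
qed

text \<open>Only \<open>M - L/2\<close>, \<open>M - m\<close> and \<open>m - L + M\<close> enter.
  This allows the tail \<open>|\<nu>^(i+1)|\<close> to be subtracted before the univariate relation
  is applied.\<close>

lemma edge_coeff_translate: "edge_coeff (M - k) (L - 2 * k) (m - k) s = edge_coeff M L m s"
  by (simp add: edge_coeff_def field_simps)

lemma hahn_Q_poly_R:
  assumes "pochhammer (- a) n \<noteq> 0"
  shows "hahn_Q_poly n t a b M = hahn_R (int n) t a b (- M) / pochhammer (- a) n"
proof -
  have "pochhammer (- a + real k) (n - k) = pochhammer (- a) n / pochhammer (- a) k" if "k \<le> n" for k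
    using assms pochhammer_product[OF that, of "- a"] by auto
  then show ?thesis
    using assms unfolding hahn_Q_poly_def hahn_R_def
    by (simp add: sum_divide_distrib)
qed

lemma pochhammer_int_nonzero:
  assumes "0 \<le> v" "v \<le> l"
  shows "pochhammer (- real_of_int l) (nat v) \<noteq> 0"
  using assms by (auto simp: pochhammer_eq_0_iff)

lemma pochhammer_int_add_1:
  "0 \<le> v \<Longrightarrow> pochhammer a (nat (v + 1)) = pochhammer a (nat v) * (a + real_of_int v)"
  by (simp add: nat_add_distrib pochhammer_Suc)

text \<open>At the origin only the term \<open>k = 0\<close> of each factor survives, leaving
  \<open>(-N + |\<nu>^(j+1)|)_(\<nu>_j)\<close>. These symbols concatenate to
  \<open>(-N)_|\<nu>|\<close>, which is nonzero for \<open>|\<nu>| \<le> N\<close>.\<close>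

lemma Q_hat_origin:
  assumes nn: "nonneg_index d \<nu>" and N: "tail_sum d \<nu> 1 \<le> N"
  shows "Q_hat d l N (\<lambda>_. 0) \<nu> = 1"
proof -
  have origin: "hahn_Q_poly n 0 a b M = pochhammer (- M) n" for n a b M
    by (simp add: hahn_Q_poly_def pochhammer_0_left if_distrib[of "\<lambda>u. _ * u"] if_distrib[of "\<lambda>u. u * _"]
        if_distrib[of "\<lambda>u. u / _"] sum.delta cong: if_cong)
  have "(\<Prod>j\<in>{i..d}. pochhammer (- NN d \<nu> N (\<lambda>_. 0) j) (nat (\<nu> j))) =
      pochhammer (- real_of_int N) (nat (tail_sum d \<nu> i))" if "i \<le> d + 1" "1 \<le> i" for i
    using that
  proof (induction i rule: inc_induct)
    case base
    then show ?case by (simp add: tail_sum_beyond)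
  next
    case (step i)
    then have i: "i \<in> {1..d}" by auto
    then have nu: "0 \<le> \<nu> i" "0 \<le> tail_sum d \<nu> (i + 1)"
      using nn tail_sum_nonneg[OF nn, of "i + 1"] by (auto simp: nonneg_index_def)
    have "(\<Prod>j\<in>{i..d}. pochhammer (- NN d \<nu> N (\<lambda>_. 0) j) (nat (\<nu> j))) =
       pochhammer (- NN d \<nu> N (\<lambda>_. 0) i) (nat (\<nu> i)) * pochhammer (- real_of_int N) (nat (tail_sum d \<nu> (i + 1)))"
      using i step.IH by (simp add: prod.atLeast_Suc_atMost)
    also have "\<dots> = pochhammer (- real_of_int N) (nat (tail_sum d \<nu> (i + 1)) + nat (\<nu> i))"
      using nu by (simp add: pochhammer_product' NN_def)
    also have "nat (tail_sum d \<nu> (i + 1)) + nat (\<nu> i) = nat (tail_sum d \<nu> i)"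
      using nu i tail_sum_rec[of i d \<nu>] by simp
    finally show ?case .
  qed
  from this[of 1] have "(\<Prod>j\<in>{1..d}. pochhammer (- NN d \<nu> N (\<lambda>_. 0) j) (nat (\<nu> j))) =
      pochhammer (- real_of_int N) (nat (tail_sum d \<nu> 1))" by simp
  moreover have "pochhammer (- real_of_int N) (nat (tail_sum d \<nu> 1)) \<noteq> 0"
    using tail_sum_nonneg[OF nn, of 1] N by (intro pochhammer_int_nonzero) auto
  ultimately show ?thesis
    using nn by (simp add: Q_hat_def origin)
qed

text \<open>Conditions extracted from admissibility in a form that can be checked for the reduced
  parameters as well: \<open>below\<close> keeps the denominators \<open>b_i\<close> nonzero,
  \<open>size\<close> the symbols in \<open>- N\<close>, and \<open>le_l\<close> those in
  \<open>- l i\<close>.\<close>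

context
  fixes d :: nat and l :: "nat \<Rightarrow> int" and N :: int and \<nu> :: "nat \<Rightarrow> int"
  assumes nonneg: "nonneg_index d \<nu>"
    and below: "\<And>i. i \<in> {1..d} \<Longrightarrow> 2 * tail_sum d \<nu> i < tail_sum (d + 1) l i"
    and size: "tail_sum d \<nu> 1 < N"
    and le_l: "\<And>\<mu> i. \<mu> \<in> signs d \<Longrightarrow> nonneg_index d (shift d \<mu> \<nu>) \<Longrightarrow> i \<in> {1..d} \<Longrightarrow> shift d \<mu> \<nu> i \<le> l i"
begin

section \<open>The top operator applied to the normalized polynomials\<close>

lemma shift_zero: "shift d (\<lambda>_. 0) \<nu> = \<nu>"
  by (auto simp: shift_def)

lemma zero_signs: "(\<lambda>_. 0) \<in> signs d"
  by (simp add: signs_def)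

text \<open>Passing from \<open>hahn_Q_poly\<close> to \<open>hahn_R\<close> divides by a symbol
  that depends on the shifted degree. Its quotient with the unshifted symbol has at most two linear
  factors, which \<open>step_coeff\<close> absorbs.\<close>

lemma B_coeff_step:
  assumes i: "i \<in> {1..d}" and s: "s \<in> {-1, 0, 1}" and t: "t \<in> {-1, 0, 1}"
    and v: "0 \<le> \<nu> i + s - t" "\<nu> i + s - t \<le> l i"
  shows "B_coeff d \<nu> l N i s t / pochhammer (- real_of_int (l i)) (nat (\<nu> i + s - t)) =
    step_coeff (\<nu> i) (l i) (aa d \<nu> l i) s t / pochhammer (- real_of_int (l i)) (nat (\<nu> i))"
proof -
  define P where "P v = pochhammer (- real_of_int (l i)) (nat v)" for v
  have v0: "0 \<le> \<nu> i" using nonneg i by (simp add: nonneg_index_def)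
  have vl: "\<nu> i \<le> l i" using le_l[OF zero_signs] nonneg i by (simp add: shift_zero)
  have P: "P (u + 1) = P u * (real_of_int u - l i)" if "0 \<le> u" for u
    using pochhammer_int_add_1[OF that] by (simp add: P_def)
  have Pnz: "P (\<nu> i) \<noteq> 0" "P (\<nu> i + s - t) \<noteq> 0"
    using pochhammer_int_nonzero[OF v0 vl] pochhammer_int_nonzero[OF v] by (simp_all add: P_def)
  have L: "tail_sum (d + 1) l i = l i + tail_sum (d + 1) l (i + 1)"
    and n: "tail_sum d \<nu> i = \<nu> i + tail_sum d \<nu> (i + 1)"
    using i tail_sum_rec[of i "d + 1" l] tail_sum_rec[of i d \<nu>] by auto
  have "i \<noteq> 0" using i by auto
  have "B_coeff d \<nu> l N i s t * P (\<nu> i) = step_coeff (\<nu> i) (l i) (aa d \<nu> l i) s t * P (\<nu> i + s - t)"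
  proof -
    define b where "b = real_of_int (aa d \<nu> l i)"
    define k where "k = real_of_int (tail_sum d \<nu> (i + 1))"
    have b: "real_of_int (tail_sum (d + 1) l (i + 1)) = b + 2 * k"
      by (simp add: b_def k_def aa_def)
    have L': "real_of_int (tail_sum (d + 1) l i) = l i + b + 2 * k"
      unfolding L using b by simp
    have n': "real_of_int (tail_sum d \<nu> i) = \<nu> i + k"
      unfolding n k_def by simp
    note B = B_coeff_def step_coeff_def Let_def L' n' b b_def[symmetric] k_def[symmetric]
    consider "s = 0" "t = 0" | "s = 0" "t = 1" | "s = 0" "t = -1" | "s = 1" "t = 0" | "s = -1" "t = 0"
      | "s = 1" "t = 1" | "s = -1" "t = 1" | "s = 1" "t = -1" | "s = -1" "t = -1"
      using s t by auto
    then show ?thesis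
    proof cases
      case 1
      then show ?thesis unfolding B using \<open>i \<noteq> 0\<close> by (simp add: field_simps)
    next
      case 2
      have p: "P (\<nu> i) = P (\<nu> i - 1) * (real_of_int (\<nu> i) - 1 - l i)" using P[of "\<nu> i - 1"] v 2 by simp
      show ?thesis unfolding B p using \<open>i \<noteq> 0\<close> 2 by (simp add: algebra_simps)
    next
      case 3
      have p: "P (\<nu> i + s - t) = P (\<nu> i) * (real_of_int (\<nu> i) - l i)" using P[of "\<nu> i"] v0 3 by simp
      show ?thesis unfolding B p using \<open>i \<noteq> 0\<close> 3 by (simp add: algebra_simps)
    next
      case 4
      have p: "P (\<nu> i + s - t) = P (\<nu> i) * (real_of_int (\<nu> i) - l i)" using P[of "\<nu> i"] v0 4 by simp
      show ?thesis unfolding B p using \<open>i \<noteq> 0\<close> 4 by (simp add: algebra_simps)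
    next
      case 5
      have p: "P (\<nu> i) = P (\<nu> i - 1) * (real_of_int (\<nu> i) - 1 - l i)" using P[of "\<nu> i - 1"] v 5 by simp
      show ?thesis unfolding B p using \<open>i \<noteq> 0\<close> 5 by (simp add: algebra_simps)
    next
      case 6
      then show ?thesis unfolding B using \<open>i \<noteq> 0\<close> by (simp add: algebra_simps)
    next
      case 7
      have p: "P (\<nu> i) = P (\<nu> i - 1) * (real_of_int (\<nu> i) - 1 - l i)"
        "P (\<nu> i - 1) = P (\<nu> i - 2) * (real_of_int (\<nu> i) - 2 - l i)"
        using P[of "\<nu> i - 1"] P[of "\<nu> i - 2"] v 7 by simp_all
      show ?thesis unfolding B p using \<open>i \<noteq> 0\<close> 7 by (simp add: algebra_simps)
    next
      case 8
      have p: "P (\<nu> i + s - t) = P (\<nu> i) * (real_of_int (\<nu> i) - l i) * (real_of_int (\<nu> i) + 1 - l i)"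
        using P[of "\<nu> i + 1"] P[of "\<nu> i"] v0 8 by simp
      show ?thesis unfolding B p using \<open>i \<noteq> 0\<close> 8 by (simp add: algebra_simps)
    next
      case 9
      then show ?thesis unfolding B using \<open>i \<noteq> 0\<close> by (simp add: algebra_simps)
    qed
  qed
  then show ?thesis using Pnz unfolding P_def by (simp add: divide_simps)
qed

text \<open>For \<open>s = 1\<close> the factor \<open>N - |\<nu>|\<close> cancels, up to sign, the
  new factor of the Pochhammer symbol; strictness in \<open>size\<close> keeps that symbol
  nonzero.\<close>

lemma B_coeff_edge:
  assumes s: "s \<in> {-1, 0, 1}" and v: "0 \<le> tail_sum d \<nu> 1 + s"
  shows "B_coeff d \<nu> l N 0 0 s / pochhammer (- real_of_int N) (nat (tail_sum d \<nu> 1 + s)) =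
    edge_coeff N (tail_sum (d + 1) l 1) (tail_sum d \<nu> 1) s / pochhammer (- real_of_int N) (nat (tail_sum d \<nu> 1))"
proof -
  define n where "n = tail_sum d \<nu> 1"
  define P where "P v = pochhammer (- real_of_int N) (nat v)" for v
  have n0: "0 \<le> n" unfolding n_def using nonneg by (rule tail_sum_nonneg) simp
  have P: "P (u + 1) = P u * (real_of_int u - N)" if "0 \<le> u" for u
    using pochhammer_int_add_1[OF that] by (simp add: P_def)
  have Pnz: "P n \<noteq> 0" "P (n + s) \<noteq> 0"
    using pochhammer_int_nonzero[of n N] pochhammer_int_nonzero[of "n + s" N] size s n0 v
    by (auto simp: P_def n_def)
  have "B_coeff d \<nu> l N 0 0 s * P n = edge_coeff N (tail_sum (d + 1) l 1) n s * P (n + s)"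
  proof -
    consider "s = 0" | "s = 1" | "s = -1" using s by auto
    then show ?thesis
    proof cases
      case 3
      have p: "P n = P (n - 1) * (real_of_int n - 1 - N)" using P[of "n - 1"] v 3 by (simp add: n_def)
      show ?thesis unfolding p using 3 by (simp add: B_coeff_def edge_coeff_def n_def algebra_simps)
    qed (use P[of n] n0 in \<open>simp_all add: B_coeff_def edge_coeff_def n_def algebra_simps\<close>)
  qed
  then show ?thesis using Pnz unfolding P_def n_def by (simp add: divide_simps)
qed

text \<open>What replaces \<open>N\<close> once the coordinates before \<open>i\<close> have been
  summed out.\<close>

definition M_at :: "(nat \<Rightarrow> real) \<Rightarrow> nat \<Rightarrow> real"
  where "M_at x i = of_int N - (\<Sum>j\<in>{1..<i}. x j)"

definition R_at :: "(nat \<Rightarrow> real) \<Rightarrow> nat \<Rightarrow> int \<Rightarrow> int \<Rightarrow> real"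
  where "R_at x i s t = hahn_R (\<nu> i + s - t) (x i) (l i) (aa d \<nu> l i - 2 * of_int t)
     (tail_sum d \<nu> (i + 1) + of_int t - M_at x i)"

text \<open>The entry of the \<open>i\<close>-th transfer matrix at \<open>s = \<mu>_i\<close>,
  \<open>t = \<mu>_(i+1)\<close>.\<close>

definition A_at :: "(nat \<Rightarrow> real) \<Rightarrow> nat \<Rightarrow> int \<Rightarrow> int \<Rightarrow> real"
  where "A_at x i s t = step_coeff (\<nu> i) (l i) (aa d \<nu> l i) s t /
     denom (2 * tail_sum d \<nu> i - tail_sum (d + 1) l i) s * R_at x i s t"

text \<open>The normalization at the unshifted index, which does not depend on
  \<open>\<mu>\<close>.\<close>

definition scale :: real
  where "scale = 1 / (pochhammer (- real_of_int N) (nat (tail_sum d \<nu> 1)) *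
     (\<Prod>i\<in>{1..d}. pochhammer (- real_of_int (l i)) (nat (\<nu> i))))"

text \<open>The \<open>i\<close>-th factor sees the shift only through \<open>\<nu>_i\<close>, which
  moves by \<open>\<mu>_i - \<mu>_(i+1)\<close>, and through the tail beyond \<open>i\<close>, which
  moves by \<open>\<mu>_(i+1)\<close>.\<close>

lemma Q_hat_shift:
  assumes \<mu>: "\<mu> \<in> signs d" and nn: "nonneg_index d (shift d \<mu> \<nu>)"
  shows "Q_hat d l N x (shift d \<mu> \<nu>) = 1 / pochhammer (- real_of_int N) (nat (tail_sum d \<nu> 1 + \<mu> 1)) *
     (\<Prod>i\<in>{1..d}. R_at x i (\<mu> i) (\<mu> (i + 1)) / pochhammer (- real_of_int (l i)) (nat (\<nu> i + \<mu> i - \<mu> (i + 1))))"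
proof -
  have "hahn_Q_poly (nat (shift d \<mu> \<nu> i)) (x i) (l i) (aa d (shift d \<mu> \<nu>) l i) (NN d (shift d \<mu> \<nu>) N x i) =
    R_at x i (\<mu> i) (\<mu> (i + 1)) / pochhammer (- real_of_int (l i)) (nat (\<nu> i + \<mu> i - \<mu> (i + 1)))"
    if i: "i \<in> {1..d}" for i
  proof -
    have 0: "0 \<le> shift d \<mu> \<nu> i" using nn i by (simp add: nonneg_index_def)
    have nz: "pochhammer (- real_of_int (l i)) (nat (shift d \<mu> \<nu> i)) \<noteq> 0"
      using 0 le_l[OF \<mu> nn i] by (rule pochhammer_int_nonzero)
    have s: "shift d \<mu> \<nu> i = \<nu> i + \<mu> i - \<mu> (i + 1)" using i by (simp add: shift_def)
    have a: "real_of_int (aa d (shift d \<mu> \<nu>) l i) = aa d \<nu> l i - 2 * of_int (\<mu> (i + 1))"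
      using i by (simp add: aa_def tail_sum_shift[OF \<mu>])
    have M: "- NN d (shift d \<mu> \<nu>) N x i = tail_sum d \<nu> (i + 1) + of_int (\<mu> (i + 1)) - M_at x i"
      using i by (simp add: NN_def M_at_def tail_sum_shift[OF \<mu>])
    show ?thesis
      unfolding hahn_Q_poly_R[OF nz] M a R_at_def using 0 unfolding s by simp
  qed
  then have "(\<Prod>i\<in>{1..d}. hahn_Q_poly (nat (shift d \<mu> \<nu> i)) (x i) (l i) (aa d (shift d \<mu> \<nu>) l i) (NN d (shift d \<mu> \<nu>) N x i)) =
    (\<Prod>i\<in>{1..d}. R_at x i (\<mu> i) (\<mu> (i + 1)) / pochhammer (- real_of_int (l i)) (nat (\<nu> i + \<mu> i - \<mu> (i + 1))))"
    by (rule prod.cong[OF refl])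
  then show ?thesis
    using nn tail_sum_shift[OF \<mu>, of 1] unfolding Q_hat_def by simp
qed

text \<open>Each summand factorizes along consecutive pairs of signs. This includes shifts to
  negative indices, where \<open>Q_hat\<close> and \<open>hahn_R\<close> are both zero by
  convention.\<close>

lemma C_coeff_Q_hat:
  assumes \<mu>: "\<mu> \<in> signs d"
  shows "C_coeff d \<nu> l N \<mu> * Q_hat d l N x (shift d \<mu> \<nu>) =
    scale * (edge_coeff N (tail_sum (d + 1) l 1) (tail_sum d \<nu> 1) (\<mu> 1) * (\<Prod>i\<in>{1..d}. A_at x i (\<mu> i) (\<mu> (i + 1))))"
proof (cases "nonneg_index d (shift d \<mu> \<nu>)")
  case False
  then obtain i where i: "i \<in> {1..d}" "\<nu> i + \<mu> i - \<mu> (i + 1) < 0"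
    by (auto simp: nonneg_index_def shift_def not_le algebra_simps)
  then have "A_at x i (\<mu> i) (\<mu> (i + 1)) = 0"
    by (simp add: A_at_def R_at_def hahn_R_def)
  then have "(\<Prod>i\<in>{1..d}. A_at x i (\<mu> i) (\<mu> (i + 1))) = 0"
    using i(1) by (intro prod_zero) auto
  then show ?thesis using False by (simp add: Q_hat_def)
next
  case True
  have sg: "\<mu> i \<in> {-1, 0, 1}" for i using \<mu> by (cases "i \<in> {1..d}") (auto simp: signs_def)
  have \<mu>0: "\<mu> 0 = 0" using \<mu> by (simp add: signs_def)
  let ?N = "\<lambda>v. pochhammer (- real_of_int N) (nat v)"
  let ?l = "\<lambda>i v. pochhammer (- real_of_int (l i)) (nat v)"
  have factor: "B_coeff d \<nu> l N i (\<mu> i) (\<mu> (i + 1)) / b_coeff d \<nu> l i (\<mu> i) *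
      (R_at x i (\<mu> i) (\<mu> (i + 1)) / ?l i (\<nu> i + \<mu> i - \<mu> (i + 1))) =
      A_at x i (\<mu> i) (\<mu> (i + 1)) / ?l i (\<nu> i)" if i: "i \<in> {1..d}" for i
  proof -
    have 0: "0 \<le> \<nu> i + \<mu> i - \<mu> (i + 1)" "\<nu> i + \<mu> i - \<mu> (i + 1) \<le> l i"
      using True le_l[OF \<mu> True i] i by (auto simp: nonneg_index_def shift_def algebra_simps)
    have b: "b_coeff d \<nu> l i (\<mu> i) = denom (2 * tail_sum d \<nu> i - tail_sum (d + 1) l i) (\<mu> i)"
      by (simp add: b_coeff_def denom_def Let_def)
    have "B_coeff d \<nu> l N i (\<mu> i) (\<mu> (i + 1)) / b_coeff d \<nu> l i (\<mu> i) *
      (R_at x i (\<mu> i) (\<mu> (i + 1)) / ?l i (\<nu> i + \<mu> i - \<mu> (i + 1))) =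
      (B_coeff d \<nu> l N i (\<mu> i) (\<mu> (i + 1)) / ?l i (\<nu> i + \<mu> i - \<mu> (i + 1))) / b_coeff d \<nu> l i (\<mu> i) * R_at x i (\<mu> i) (\<mu> (i + 1))"
      by simp
    then show ?thesis
      unfolding B_coeff_step[OF i sg sg 0] b A_at_def by (simp add: mult_ac)
  qed
  have n0: "0 \<le> tail_sum d \<nu> 1 + \<mu> 1"
    using tail_sum_nonneg[OF True, of 1] tail_sum_shift[OF \<mu>, of 1] by simp
  have "C_coeff d \<nu> l N \<mu> * Q_hat d l N x (shift d \<mu> \<nu>) =
     (B_coeff d \<nu> l N 0 0 (\<mu> 1) / ?N (tail_sum d \<nu> 1 + \<mu> 1)) *
     (\<Prod>i\<in>{1..d}. B_coeff d \<nu> l N i (\<mu> i) (\<mu> (i + 1)) / b_coeff d \<nu> l i (\<mu> i) *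
      (R_at x i (\<mu> i) (\<mu> (i + 1)) / ?l i (\<nu> i + \<mu> i - \<mu> (i + 1))))"
    unfolding Q_hat_shift[OF \<mu> True] C_coeff_def prod.distrib prod_dividef
    by (simp add: prod.atLeast_Suc_atMost \<mu>0 mult_ac)
  also have "(\<Prod>i\<in>{1..d}. B_coeff d \<nu> l N i (\<mu> i) (\<mu> (i + 1)) / b_coeff d \<nu> l i (\<mu> i) *
      (R_at x i (\<mu> i) (\<mu> (i + 1)) / ?l i (\<nu> i + \<mu> i - \<mu> (i + 1)))) =
     (\<Prod>i\<in>{1..d}. A_at x i (\<mu> i) (\<mu> (i + 1)) / ?l i (\<nu> i))"
    by (rule prod.cong[OF refl factor])
  finally show ?thesis
    unfolding B_coeff_edge[OF sg n0] by (simp add: scale_def prod_dividef)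
qed

text \<open>The univariate relation with \<open>b = aa d \<nu> l i\<close> and
  \<open>y = |\<nu>^(i+1)| - M_at x i\<close>; both edge vectors are translated by
  \<open>|\<nu>^(i+1)|\<close>.\<close>

lemma local_relation_at:
  assumes i: "i \<in> {1..d}" and t: "t \<in> {-1, 0, 1}"
  shows "(\<Sum>s\<in>{-1, 0, 1}. edge_coeff (M_at x i) (tail_sum (d + 1) l i) (tail_sum d \<nu> i) s * A_at x i s t) =
    R_at x i 0 0 * edge_coeff (M_at x (i + 1)) (tail_sum (d + 1) l (i + 1)) (tail_sum d \<nu> (i + 1)) t"
proof -
  define n where "n = nat (\<nu> i)"
  define k where "k = real_of_int (tail_sum d \<nu> (i + 1))"
  have v0: "0 \<le> \<nu> i" using nonneg i by (simp add: nonneg_index_def)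
  have L: "real_of_int (tail_sum (d + 1) l i) = l i + tail_sum (d + 1) l (i + 1)"
    and m: "real_of_int (tail_sum d \<nu> i) = \<nu> i + k"
    using i by (auto simp: tail_sum_rec[of i] k_def)
  have b: "real_of_int (aa d \<nu> l i) = tail_sum (d + 1) l (i + 1) - 2 * k"
    by (simp add: aa_def k_def)
  have Ms: "M_at x (i + 1) = M_at x i - x i" using i by (simp add: M_at_def)
  have n: "int n = \<nu> i" "real n = \<nu> i" using v0 by (auto simp: n_def)
  have w: "2 * real n - l i - aa d \<nu> l i = 2 * tail_sum d \<nu> i - tail_sum (d + 1) l i"
    using L m by (simp add: b n)
  have neg: "2 * real n - l i - aa d \<nu> l i < 0"
    unfolding w using below[OF i] by (simp flip: of_int_less_iff)
  have e1: "edge_coeff (- (k - M_at x i)) (real_of_int (l i) + real_of_int (aa d \<nu> l i)) (real n) s = edge_coeff (M_at x i) (tail_sum (d + 1) l i) (tail_sum d \<nu> i) s" for s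
    using edge_coeff_translate[of "M_at x i" k "tail_sum (d + 1) l i" "tail_sum d \<nu> i" s]
    using m L by (simp add: b n algebra_simps)
  have e2: "edge_coeff (- (k - M_at x i) - x i) (aa d \<nu> l i) 0 t = edge_coeff (M_at x (i + 1)) (tail_sum (d + 1) l (i + 1)) k t"
    using edge_coeff_translate[of "M_at x (i + 1)" k "tail_sum (d + 1) l (i + 1)" k t]
    unfolding Ms by (simp add: b algebra_simps)
  show ?thesis
    using local_relation[OF neg t, where x = "x i" and y = "k - M_at x i"]
    unfolding e1 e2 w unfolding A_at_def R_at_def n by (simp add: k_def algebra_simps)
qed

lemma sum_C_coeff_Q_hat:
  "(\<Sum>\<mu>\<in>signs d. C_coeff d \<nu> l N \<mu> * Q_hat d l N x (shift d \<mu> \<nu>)) =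
    ((\<Sum>j\<in>{1..d}. x j) - real_of_int N + l (d + 1) / 2) * Q_hat d l N x \<nu>"
proof -
  let ?g = "\<lambda>i. edge_coeff (M_at x i) (tail_sum (d + 1) l i) (tail_sum d \<nu> i)"
  have "(\<Sum>\<mu>\<in>signs d. C_coeff d \<nu> l N \<mu> * Q_hat d l N x (shift d \<mu> \<nu>)) =
    scale * (\<Sum>\<mu>\<in>signs d. ?g 1 (\<mu> 1) * (\<Prod>i\<in>{1..d}. A_at x i (\<mu> i) (\<mu> (i + 1))))"
    by (simp add: C_coeff_Q_hat sum_distrib_left M_at_def)
  \<comment> \<open>The right boundary value is \<open>\<mu>_(d+1) = 0\<close>, so the component
    \<open>t = 0\<close> of the last edge vector is selected.\<close>
  also have "(\<Sum>\<mu>\<in>signs d. ?g 1 (\<mu> 1) * (\<Prod>i\<in>{1..d}. A_at x i (\<mu> i) (\<mu> (i + 1)))) =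
     (\<Sum>\<mu>\<in>signs d. ?g 1 ((\<mu>(d + 1 := 0)) 1) * (\<Prod>i\<in>{1..d}. A_at x i (\<mu> i) ((\<mu>(d + 1 := 0)) (i + 1))))"
  proof (rule sum.cong)
    fix \<mu> assume "\<mu> \<in> signs d"
    then have "\<mu>(d + 1 := 0) = \<mu>" by (auto simp: signs_def)
    then show "?g 1 (\<mu> 1) * (\<Prod>i\<in>{1..d}. A_at x i (\<mu> i) (\<mu> (i + 1))) =
      ?g 1 ((\<mu>(d + 1 := 0)) 1) * (\<Prod>i\<in>{1..d}. A_at x i (\<mu> i) ((\<mu>(d + 1 := 0)) (i + 1)))" by simp
  qed simp
  also have "\<dots> = (\<Prod>i\<in>{1..d}. R_at x i 0 0) * ?g (d + 1) 0"
    by (rule sum_signs_transfer) (use local_relation_at in auto)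
  also have "?g (d + 1) 0 = (\<Sum>j\<in>{1..d}. x j) - real_of_int N + l (d + 1) / 2"
    by (simp add: edge_coeff_def M_at_def tail_sum_def atLeastLessThanSuc_atLeastAtMost)
  also have "scale * ((\<Prod>i\<in>{1..d}. R_at x i 0 0) * ((\<Sum>j\<in>{1..d}. x j) - real_of_int N + l (d + 1) / 2)) =
    ((\<Sum>j\<in>{1..d}. x j) - real_of_int N + l (d + 1) / 2) * Q_hat d l N x \<nu>"
    using Q_hat_shift[OF zero_signs, of x] nonneg unfolding shift_zero
    by (simp add: scale_def prod_dividef)
  finally show ?thesis .
qed

text \<open>With \<open>\<nu>_i \<ge> 0\<close>, a negative shifted entry requires
  \<open>\<nu>_i = 0\<close> and a step down by one, or \<open>\<nu>_i \<le> 1\<close> and a step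
  down by two. Then \<open>B_i\<close> contains a vanishing factor \<open>\<nu>_i\<close> or
  \<open>\<nu>_i (\<nu>_i - 1)\<close>.\<close>

lemma C_coeff_zero:
  assumes \<mu>: "\<mu> \<in> signs d" and "\<not> nonneg_index d (shift d \<mu> \<nu>)"
  shows "C_coeff d \<nu> l N \<mu> = 0"
proof -
  obtain i where i: "i \<in> {1..d}" "\<nu> i + (\<mu> i - \<mu> (i + 1)) < 0"
    using assms(2) by (auto simp: nonneg_index_def shift_def not_le)
  have "\<mu> i \<in> {-1, 0, 1}" "\<mu> (i + 1) \<in> {-1, 0, 1}"
    using \<mu> by (cases "i = d", auto simp: signs_def)
  moreover have "0 \<le> \<nu> i" using nonneg i by (simp add: nonneg_index_def)
  ultimately have "\<nu> i = 0 \<and> (\<mu> i = 0 \<and> \<mu> (i + 1) = 1 \<or> \<mu> i = -1 \<and> \<mu> (i + 1) = 0) \<or>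
      (\<nu> i = 0 \<or> \<nu> i = 1) \<and> \<mu> i = -1 \<and> \<mu> (i + 1) = 1"
    using i(2) by auto
  then have "B_coeff d \<nu> l N i (\<mu> i) (\<mu> (i + 1)) = 0"
    using i(1) by (auto simp: B_coeff_def Let_def)
  then have "(\<Prod>k\<in>{0..d}. B_coeff d \<nu> l N k (\<mu> k) (\<mu> (k + 1))) = 0"
    using i(1) by (intro prod_zero) auto
  then show ?thesis by (simp add: C_coeff_def)
qed

text \<open>The preceding sum at \<open>x = 0\<close>. Shifts to negative indices, where
  \<open>Q_hat\<close> is 0 and not 1, contribute nothing by \<open>C_coeff_zero\<close>.\<close>

lemma sum_C_coeff: "(\<Sum>\<mu>\<in>signs d. C_coeff d \<nu> l N \<mu>) = - N + l (d + 1) / 2"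
proof -
  have "C_coeff d \<nu> l N \<mu> * Q_hat d l N (\<lambda>_. 0) (shift d \<mu> \<nu>) = C_coeff d \<nu> l N \<mu>" if \<mu>: "\<mu> \<in> signs d" for \<mu>
  proof (cases "nonneg_index d (shift d \<mu> \<nu>)")
    case True
    have "\<mu> 1 \<in> {-1, 0, 1}" using \<mu> by (cases "1 \<in> {1..d}") (auto simp: signs_def)
    then have "\<mu> 1 \<le> 1" by auto
    then have "tail_sum d (shift d \<mu> \<nu>) 1 \<le> N"
      using size tail_sum_shift[OF \<mu>, of 1 \<nu>] by simp
    then show ?thesis using Q_hat_origin[OF True] by simp
  qed (simp add: C_coeff_zero[OF \<mu>])
  then have "(\<Sum>\<mu>\<in>signs d. C_coeff d \<nu> l N \<mu>) =
      (\<Sum>\<mu>\<in>signs d. C_coeff d \<nu> l N \<mu> * Q_hat d l N (\<lambda>_. 0) (shift d \<mu> \<nu>))"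
    by (intro sum.cong) auto
  moreover have "Q_hat d l N (\<lambda>_. 0) \<nu> = 1"
    by (rule Q_hat_origin) (use size nonneg in auto)
  ultimately show ?thesis
    unfolding sum_C_coeff_Q_hat by simp
qed

lemma L_gen_Q_hat: "L_gen d l N (Q_hat d l N x) \<nu> = (\<Sum>j\<in>{1..d}. x j) * Q_hat d l N x \<nu>"
proof -
  let ?f = "\<lambda>\<mu>. C_coeff d \<nu> l N \<mu> * (Q_hat d l N x (shift d \<mu> \<nu>) - Q_hat d l N x \<nu>)"
  \<comment> \<open>The sign vector zero may be included, since its difference vanishes.\<close>
  have "L_gen d l N (Q_hat d l N x) \<nu> = (\<Sum>\<mu>\<in>signs d. ?f \<mu>)"
    unfolding L_gen_def by (rule sum.mono_neutral_left) (auto simp: finite_signs shift_zero)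
  also have "\<dots> = (\<Sum>\<mu>\<in>signs d. C_coeff d \<nu> l N \<mu> * Q_hat d l N x (shift d \<mu> \<nu>)) -
      (\<Sum>\<mu>\<in>signs d. C_coeff d \<nu> l N \<mu>) * Q_hat d l N x \<nu>"
    by (simp add: right_diff_distrib sum_subtractf sum_distrib_right)
  also have "\<dots> = (\<Sum>j\<in>{1..d}. x j) * Q_hat d l N x \<nu>"
    unfolding sum_C_coeff_Q_hat sum_C_coeff by (simp add: algebra_simps)
  finally show ?thesis .
qed

end

subsection \<open>Reduction to the top operator\<close>

lemma tail_sum_split:
  assumes "1 \<le> i" "i \<le> k + 1" "k \<le> d"
  shows "tail_sum d v i = tail_sum k v i + tail_sum d v (k + 1)"
proof -
  have "{i..d} = {i..k} \<union> {k+1..d}" using assms by auto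
  then show ?thesis unfolding tail_sum_def by (simp add: sum.union_disjoint)
qed

lemma tail_sum_ell_red:
  assumes "i \<le> k + 1" "k \<le> d"
  shows "tail_sum (k + 1) (ell_red d \<nu> l k) i = tail_sum (d + 1) l i - 2 * tail_sum d \<nu> (k + 1)"
proof -
  have "tail_sum (k + 1) (ell_red d \<nu> l k) i = (\<Sum>j\<in>{i..k}. ell_red d \<nu> l k j) + ell_red d \<nu> l k (k + 1)"
    using assms by (simp add: tail_sum_def)
  also have "(\<Sum>j\<in>{i..k}. ell_red d \<nu> l k j) = (\<Sum>j\<in>{i..k}. l j)"
    by (rule sum.cong) (auto simp: ell_red_def)
  also have "\<dots> + ell_red d \<nu> l k (k + 1) = (\<Sum>j\<in>{i..k} \<union> {k+1..d+1}. l j) - 2 * tail_sum d \<nu> (k + 1)"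
    by (subst sum.union_disjoint) (auto simp: ell_red_def tail_sum_def)
  also have "{i..k} \<union> {k+1..d+1} = {i..d+1}" using assms by auto
  finally show ?thesis by (simp add: tail_sum_def)
qed

text \<open>Factors beyond \<open>k\<close> involve only entries beyond \<open>k\<close>, which are
  common to \<open>\<nu>\<close> and \<open>\<nu>'\<close>. The other factors see those entries only
  through tail sums, which the reduced parameters absorb, and
  \<open>(-N)_(p+q) = (-N)_p (-N+p)_q\<close> splits the normalization.\<close>

lemma Q_hat_reduce:
  assumes k: "k \<le> d" and \<nu>: "nonneg_index d \<nu>" and eq: "\<And>j. j \<notin> {1..k} \<Longrightarrow> \<nu>' j = \<nu> j"
  shows "Q_hat d l N x \<nu>' =
    1 / pochhammer (- real_of_int N) (nat (tail_sum d \<nu> (k + 1))) *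
    (\<Prod>j\<in>{k+1..d}. hahn_Q_poly (nat (\<nu> j)) (x j) (of_int (l j)) (of_int (aa d \<nu> l j)) (NN d \<nu> N x j)) *
    Q_hat k (ell_red d \<nu> l k) (N_red d \<nu> N k) x \<nu>'"
proof (cases "nonneg_index k \<nu>'")
  case False
  then have "\<not> nonneg_index d \<nu>'" using k by (auto simp: nonneg_index_def)
  then show ?thesis using False by (simp add: Q_hat_def)
next
  case True
  let ?h = "\<lambda>d l N \<nu> j. hahn_Q_poly (nat (\<nu> j)) (x j) (of_int (l j)) (of_int (aa d \<nu> l j)) (NN d \<nu> N x j)"
  have nn: "nonneg_index d \<nu>'"
    unfolding nonneg_index_def
  proof
    fix j assume "j \<in> {1..d}"
    then show "0 \<le> \<nu>' j"
      using True \<nu> eq[of j] by (cases "j \<le> k") (auto simp: nonneg_index_def)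
  qed
  have tail: "tail_sum d \<nu>' i = tail_sum d \<nu> i" if "k + 1 \<le> i" for i
    unfolding tail_sum_def using that eq by (intro sum.cong) auto
  have split: "tail_sum d \<nu>' i = tail_sum k \<nu>' i + tail_sum d \<nu> (k + 1)" if "1 \<le> i" "i \<le> k + 1" for i
    using tail_sum_split[OF that k] tail by simp
  have high: "?h d l N \<nu>' j = ?h d l N \<nu> j" if "j \<in> {k+1..d}" for j
  proof -
    have "tail_sum d \<nu>' (j + 1) = tail_sum d \<nu> (j + 1)" "\<nu>' j = \<nu> j" using that tail eq by auto
    then show ?thesis unfolding aa_def NN_def by simp
  qed
  have low: "?h d l N \<nu>' j = ?h k (ell_red d \<nu> l k) (N_red d \<nu> N k) \<nu>' j" if j: "j \<in> {1..k}" for j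
  proof -
    have "aa d \<nu>' l j = aa k \<nu>' (ell_red d \<nu> l k) j" "NN d \<nu>' N x j = NN k \<nu>' (N_red d \<nu> N k) x j"
      using j k split[of "j + 1"] tail_sum_ell_red[of "j + 1" k d \<nu> l]
      by (simp_all add: aa_def NN_def N_red_def)
    moreover have "ell_red d \<nu> l k j = l j" using j by (simp add: ell_red_def)
    ultimately show ?thesis by simp
  qed
  have "0 \<le> tail_sum d \<nu> (k + 1)" "0 \<le> tail_sum k \<nu>' 1"
    by (intro tail_sum_nonneg \<nu> True; simp)+
  then have N: "pochhammer (- real_of_int N) (nat (tail_sum d \<nu>' 1)) =
      pochhammer (- real_of_int N) (nat (tail_sum d \<nu> (k + 1))) *
      pochhammer (- real_of_int (N_red d \<nu> N k)) (nat (tail_sum k \<nu>' 1))"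
    unfolding split[OF order.refl le_add2] N_red_def
    using pochhammer_product'[of "- real_of_int N" "nat (tail_sum d \<nu> (k + 1))" "nat (tail_sum k \<nu>' 1)"]
    by (simp add: nat_add_distrib add.commute)
  have "{1..d} = {1..k} \<union> {k+1..d}" using k by auto
  then have "(\<Prod>j\<in>{1..d}. ?h d l N \<nu>' j) = (\<Prod>j\<in>{1..k}. ?h d l N \<nu>' j) * (\<Prod>j\<in>{k+1..d}. ?h d l N \<nu>' j)"
    by (simp only:) (rule prod.union_disjoint; auto)
  also have "\<dots> = (\<Prod>j\<in>{1..k}. ?h k (ell_red d \<nu> l k) (N_red d \<nu> N k) \<nu>' j) * (\<Prod>j\<in>{k+1..d}. ?h d l N \<nu> j)"
    using low high by (intro arg_cong2[where f = "(*)"] prod.cong) auto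
  finally show ?thesis
    using nn True unfolding Q_hat_def N by simp
qed

text \<open>Strictness comes from the neighbours \<open>\<nu> + e_i\<close>, which are non-negative
  and therefore lie in \<open>H_set\<close>.\<close>

lemma admissible_bounds:
  assumes adm: "admissible d l N k \<nu>" and k: "k \<in> {1..d}"
  shows "tail_sum d \<nu> 1 < N" and "i \<in> {1..k} \<Longrightarrow> 2 * tail_sum d \<nu> i < tail_sum (d + 1) l i"
proof -
  have \<nu>: "nonneg_index d \<nu>" using adm by (simp add: admissible_def H_set_def)
  \<comment> \<open>\<open>\<mu> = (1, \<dots>, 1, 0, \<dots>, 0)\<close> with \<open>i\<close> ones shifts \<open>\<nu>\<close> by the unit vector \<open>e\<^sub>i\<close>\<close>
  have unit: "\<nu>(i := \<nu> i + 1) \<in> H_set d l N" if i: "i \<in> {1..k}" for i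
  proof -
    define \<mu> :: "nat \<Rightarrow> int" where "\<mu> j = (if j \<in> {1..i} then 1 else 0)" for j
    have sh: "shift k \<mu> \<nu> = \<nu>(i := \<nu> i + 1)"
      using i by (auto simp: shift_def \<mu>_def fun_eq_iff)
    have "\<mu> \<in> signs k" using i by (auto simp: signs_def \<mu>_def)
    moreover have "\<mu> \<noteq> (\<lambda>_. 0)" using i by (auto simp: \<mu>_def fun_eq_iff intro!: exI[of _ i])
    moreover have "nonneg_index d (shift k \<mu> \<nu>)"
      unfolding sh using \<nu> by (auto simp: nonneg_index_def)
    ultimately show ?thesis using adm unfolding admissible_def sh[symmetric] by blast
  qed
  have rest: "tail_sum d (\<nu>(i := \<nu> i + 1)) (i + 1) = tail_sum d \<nu> (i + 1)" for i
    by (simp add: tail_sum_def)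
  show "tail_sum d \<nu> 1 < N"
    using unit[of 1] rest[of 1] k tail_sum_rec[of 1 d \<nu>] tail_sum_rec[of 1 d "\<nu>(1 := \<nu> 1 + 1)"]
    by (simp add: H_set_def)
  show "2 * tail_sum d \<nu> i < tail_sum (d + 1) l i" if i: "i \<in> {1..k}"
  proof -
    have i': "i \<in> {1..d}" using i k by auto
    \<comment> \<open>Adding the two bounds gives
      \<open>2 |\<nu>^i| + 2 \<le> |l^i|\<close>.\<close>
    have "\<nu> i + 1 \<le> l i" "\<nu> i + 1 \<le> aa d \<nu> l i"
      using unit[OF i] rest[of i] i' unfolding H_set_def aa_def by (auto dest!: bspec[of _ _ i])
    then show ?thesis
      using i' tail_sum_rec[of i d \<nu>] tail_sum_rec[of i "d + 1" l] by (simp add: aa_def)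
  qed
qed

theorem theorem6p2:
  fixes d :: nat and N :: int and l :: "nat \<Rightarrow> int"
  assumes "1 \<le> d"
    and "0 < N"
    and "\<forall>i\<in>{1..d + 1}. 0 < l i \<and> l i \<le> N"
    and "\<forall>i\<in>{1..d + 1}. \<forall>j\<in>{1..d + 1}. i \<noteq> j \<longrightarrow> N \<le> l i + l j"
  shows "\<forall>k\<in>{1..d}. \<forall>\<nu> :: nat \<Rightarrow> int. admissible d l N k \<nu> \<longrightarrow>
    (\<forall>\<mu>\<in>signs k - {\<lambda>_. 0}. \<not> nonneg_index d (shift k \<mu> \<nu>) \<longrightarrow>
        C_coeff k \<nu> (ell_red d \<nu> l k) (N_red d \<nu> N k) \<mu> = 0) \<and>
    (\<forall>x :: nat \<Rightarrow> real.
        L_op d l N k (Q_hat d l N x) \<nu> = (\<Sum>j\<in>{1..k}. x j) * Q_hat d l N x \<nu>)"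
proof (intro ballI allI impI conjI)
  fix k \<nu> assume k: "k \<in> {1..d}" and adm: "admissible d l N k \<nu>"
  let ?l = "ell_red d \<nu> l k" and ?N = "N_red d \<nu> N k"
  have \<nu>: "nonneg_index d \<nu>" using adm by (simp add: admissible_def H_set_def)
  have \<nu>k: "nonneg_index k \<nu>" using \<nu> k by (simp add: nonneg_index_def)
  have nn: "nonneg_index d (shift k \<mu> \<nu>) \<longleftrightarrow> nonneg_index k (shift k \<mu> \<nu>)" for \<mu>
    using \<nu> k by (auto simp: nonneg_index_def shift_def)
  have below: "2 * tail_sum k \<nu> i < tail_sum (k + 1) ?l i" if "i \<in> {1..k}" for i
    using admissible_bounds(2)[OF adm k that] tail_sum_split[of i k d \<nu>] tail_sum_ell_red[of i k d \<nu> l] that k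
    by simp
  have size: "tail_sum k \<nu> 1 < ?N"
    using admissible_bounds(1)[OF adm k] tail_sum_split[of 1 k d \<nu>] k by (simp add: N_red_def)
  have le_l: "shift k \<mu> \<nu> i \<le> ?l i"
    if "\<mu> \<in> signs k" "nonneg_index k (shift k \<mu> \<nu>)" "i \<in> {1..k}" for \<mu> i
  proof -
    have "shift k \<mu> \<nu> \<in> H_set d l N"
    proof (cases "\<mu> = (\<lambda>_. 0)")
      \<comment> \<open>Admissibility quantifies over nonzero \<open>\<mu>\<close>; here membership
        of \<open>\<nu>\<close> itself is used.\<close>
      case True
      then have "shift k \<mu> \<nu> = \<nu>" by (auto simp: shift_def)
      then show ?thesis using adm by (simp add: admissible_def)
    next
      case False
      then show ?thesis using adm that nn unfolding admissible_def by blast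
    qed
    then show ?thesis using that(3) k by (auto simp: H_set_def ell_red_def)
  qed
  note hyps = \<nu>k below size le_l
  show "C_coeff k \<nu> ?l ?N \<mu> = 0" if "\<mu> \<in> signs k - {\<lambda>_. 0}" "\<not> nonneg_index d (shift k \<mu> \<nu>)" for \<mu>
    by (rule C_coeff_zero[OF hyps]) (use that nn in auto)
  show "L_op d l N k (Q_hat d l N x) \<nu> = (\<Sum>j\<in>{1..k}. x j) * Q_hat d l N x \<nu>" for x
  proof -
    \<comment> \<open>Shifts by sign vectors of length \<open>k\<close> leave the entries beyond
      \<open>k\<close> alone, so this factor is common to all terms of the operator.\<close>
    define c where "c = 1 / pochhammer (- real_of_int N) (nat (tail_sum d \<nu> (k + 1))) *
      (\<Prod>j\<in>{k+1..d}. hahn_Q_poly (nat (\<nu> j)) (x j) (of_int (l j)) (of_int (aa d \<nu> l j)) (NN d \<nu> N x j))"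
    have c: "Q_hat d l N x (shift k \<mu> \<nu>) = c * Q_hat k ?l ?N x (shift k \<mu> \<nu>)" for \<mu>
      unfolding c_def by (rule Q_hat_reduce[OF _ \<nu>]) (use k in \<open>auto simp: shift_def\<close>)
    have c0: "Q_hat d l N x \<nu> = c * Q_hat k ?l ?N x \<nu>"
      unfolding c_def by (rule Q_hat_reduce[OF _ \<nu>]) (use k in auto)
    have "L_op d l N k (Q_hat d l N x) \<nu> = c * L_gen k ?l ?N (Q_hat k ?l ?N x) \<nu>"
      unfolding L_op_def L_gen_def sum_distrib_left c c0 right_diff_distrib[symmetric]
      by (simp only: mult.left_commute)
    also have "\<dots> = (\<Sum>j\<in>{1..k}. x j) * Q_hat d l N x \<nu>"
      using L_gen_Q_hat[OF hyps, of x] c0 by simp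
    finally show ?thesis .
  qed
qed

end
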